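(* Let $H$ be a Hilbert space, $W$ a density operator on $H$, $N$ a positive integer, and $\hat{M}_{1},\ldots ,\hat{M}_{N}$ self-adjoint operators on $H$ with spectra ${\cal M}_{1},\ldots ,{\cal M}_{N}$. Let $\tilde{p}$ be a classical probability measure on $2^{\{0,1\}^{N}}$ (the algebra of all subsets of $\{0,1\}^{N}$) such that, for every $\eta \in \{0,1\}^{N}$, if $\tilde{p}(\{\eta \})\neq 0$ then the set of operators $\{\hat{M}_{i}\}_{\eta _{i}=1}$ is commuting. Then there exists a Kolmogorovian (classical) probability space $({\cal M}, B({\cal M}), p)$ such that each conditioning event $E\in 2^{\{0,1\}^{N}}$ and each outcome event $(A_{i})_{\eta _{i}=1}$ can be represented by an element of $B({\cal M})$, denoted by $X_{E}$ and $X_{(A_{i})_{\eta _{i}=1}}$ respectively, and $$\tilde{p}(E)=p(X_{E})\qquad \text{for all } E\in 2^{\{0,1\}^{N}},$$ $$\mu_{\eta}\big((A_{i})_{\eta _{i}=1}\big)=\mathrm{tr}\Big(W\prod_{\eta _{i}=1}A_{i}\Big)=\frac{p\big(X_{(A_{i})_{\eta _{i}=1}}\cap X_{\{\eta \}}\big)}{p\big(X_{\{\eta \}}\big)}$$ for all $\eta \in \{0,1\}^{N}$ and all families $(A_{i})_{\eta _{i}=1}$ of Borel sets $A_{i}\in B({\cal M}_{i})$.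
   Context: The operators $\hat{M}_{1},\ldots,\hat{M}_{N}$ represent the observables belonging to $N$ different measurements $m_{1},\ldots ,m_{N}$ which can be carried out on a quantum system in state $W$. A vector $\eta \in \{0,1\}^{N}$ encodes the set of measurements $\{m_{i} : \eta _{i}=1\}$; subsets of $\{0,1\}^{N}$ are the conditioning events (for example, $\{\eta : \eta _{i}=1\}$ is the event "measurement $m_{i}$ is performed"), and $\tilde p$ gives their probabilities. Some measurements may be incompatible, i.e. not simultaneously performable; observables belonging to compatible measurements are assumed to commute. $B(\cdot)$ denotes the $\sigma$-algebra of Borel sets. For a Borel set $A_{i}\in B({\cal M}_{i})$ the same letter $A_{i}$ denotes the corresponding spectral projector of $\hat{M}_{i}$. The outcome event $(A_{i})_{\eta _{i}=1}$ stands for the product of the Borel sets $A_i$ with $\eta_i=1$, a Borel subset of the Cartesian product of the ${\cal M}_{i}$ with $\eta _{i}=1$. For each set $\{m_i\}_{\eta_i=1}$ of compatible measurements, $\mu_{\eta}$ is the Kolmogorovian probability measure on the Borel sets of that Cartesian product determined by the state $W$ through $\mu_{\eta}\big((A_{i})_{\eta _{i}=1}\big)=\mathrm{tr}\big(W\prod_{\eta _{i}=1}A_{i}\big)$.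
   Formalization: The second displayed equation is stated only for those η with p̃({η}) ≠ 0, since otherwise p(X_{{η}}) = 0 and the fraction is the undefined 0/0 (and the operators with η_i = 1 need not commute). *)

theory Defs
  imports "HOL-Probability.Probability"
begin

text \<open>The inner product is conjugate-linear in its first and linear in its second argument.
  The last axiom says that the norm is the one induced by the (positive definite) inner product.\<close>

class complex_hilbert_space = real_normed_vector + complete_space +
  fixes scaleC :: "complex \<Rightarrow> 'a \<Rightarrow> 'a" (infixr "*\<^sub>C" 75)
    and cinner :: "'a \<Rightarrow> 'a \<Rightarrow> complex"
  assumes scaleC_add_right: "c *\<^sub>C (x + y) = c *\<^sub>C x + c *\<^sub>C y"
    and scaleC_add_left: "(c + d) *\<^sub>C x = c *\<^sub>C x + d *\<^sub>C x"
    and scaleC_scaleC: "c *\<^sub>C (d *\<^sub>C x) = (c * d) *\<^sub>C x"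
    and scaleR_eq_scaleC: "scaleR r x = complex_of_real r *\<^sub>C x"
    and cinner_commute: "cinner x y = cnj (cinner y x)"
    and cinner_add_right: "cinner x (y + z) = cinner x y + cinner x z"
    and cinner_scaleC_right: "cinner x (c *\<^sub>C y) = c * cinner x y"
    and cinner_same: "cinner x x = complex_of_real ((norm x)\<^sup>2)"


subsection \<open>Everywhere defined bounded operators, trace, density operators\<close>

definition bounded_clinear :: "('a::complex_hilbert_space \<Rightarrow> 'a) \<Rightarrow> bool" where
  "bounded_clinear T \<longleftrightarrow> bounded_linear T \<and> (\<forall>c x. T (c *\<^sub>C x) = c *\<^sub>C T x)"

definition positive_operator :: "('a::complex_hilbert_space \<Rightarrow> 'a) \<Rightarrow> bool" where
  "positive_operator T \<longleftrightarrow> (\<forall>x. cinner x (T x) \<in> \<real> \<and> 0 \<le> Re (cinner x (T x)))"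

definition orthogonal_projector :: "('a::complex_hilbert_space \<Rightarrow> 'a) \<Rightarrow> bool" where
  "orthogonal_projector Q \<longleftrightarrow>
     bounded_clinear Q \<and> Q \<circ> Q = Q \<and> (\<forall>x y. cinner (Q x) y = cinner x (Q y))"

definition orthonormal_basis :: "'a::complex_hilbert_space set \<Rightarrow> bool" where
  "orthonormal_basis B \<longleftrightarrow>
     (\<forall>b\<in>B. \<forall>c\<in>B. cinner b c = (if b = c then 1 else 0)) \<and>
     (\<forall>x. (\<forall>b\<in>B. cinner b x = 0) \<longrightarrow> x = 0)"

text \<open>For trace-class operators the sum converges absolutely and does not depend on the
  basis.  The basis may be uncountable: separability is not assumed.\<close>

definition operator_trace :: "('a::complex_hilbert_space \<Rightarrow> 'a) \<Rightarrow> complex" where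
  "operator_trace T = (\<Sum>\<^sub>\<infinity>b\<in>(SOME B. orthonormal_basis B). cinner b (T b))"

text \<open>A divergent \<^const>\<open>infsum\<close> is 0, so for a positive operator the requirement
  that the trace be 1 includes that the operator is trace class.\<close>

definition density_operator :: "('a::complex_hilbert_space \<Rightarrow> 'a) \<Rightarrow> bool" where
  "density_operator W \<longleftrightarrow> bounded_clinear W \<and> positive_operator W \<and> operator_trace W = 1"


subsection \<open>Possibly unbounded operators\<close>

text \<open>An operator \<open>T :: 'a \<rightharpoonup> 'a\<close> is a partial function; its domain is \<^term>\<open>dom T\<close>.\<close>

definition linear_operator :: "('a::complex_hilbert_space \<rightharpoonup> 'a) \<Rightarrow> bool" where
  "linear_operator T \<longleftrightarrow>
     0 \<in> dom T \<and>
     (\<forall>x\<in>dom T. \<forall>y\<in>dom T. T (x + y) = Some (the (T x) + the (T y))) \<and>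
     (\<forall>c. \<forall>x\<in>dom T. T (c *\<^sub>C x) = Some (c *\<^sub>C the (T x)))"

text \<open>If \<^term>\<open>dom T\<close> is dense, the vector \<open>z\<close> below is unique when it exists.\<close>

definition adjoint_operator ::
    "('a::complex_hilbert_space \<rightharpoonup> 'a) \<Rightarrow> ('a \<rightharpoonup> 'a)" where
  "adjoint_operator T = (\<lambda>y.
     if \<exists>z. \<forall>x\<in>dom T. cinner (the (T x)) y = cinner x z
     then Some (THE z. \<forall>x\<in>dom T. cinner (the (T x)) y = cinner x z)
     else None)"

definition self_adjoint :: "('a::complex_hilbert_space \<rightharpoonup> 'a) \<Rightarrow> bool" where
  "self_adjoint T \<longleftrightarrow>
     linear_operator T \<and> closure (dom T) = UNIV \<and> adjoint_operator T = T"

text \<open>The resolvent set: \<open>T - z\<close> has an everywhere defined bounded inverse \<open>R\<close>.\<close>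

definition resolvent_set :: "('a::complex_hilbert_space \<rightharpoonup> 'a) \<Rightarrow> complex set" where
  "resolvent_set T = {z. \<exists>R. bounded_clinear R \<and>
     (\<forall>x\<in>dom T. R (the (T x) - z *\<^sub>C x) = x) \<and>
     (\<forall>y. R y \<in> dom T \<and> the (T (R y)) - z *\<^sub>C R y = y)}"

definition spectrum :: "('a::complex_hilbert_space \<rightharpoonup> 'a) \<Rightarrow> complex set" where
  "spectrum T = - resolvent_set T"

text \<open>The spectrum of a self-adjoint operator is real, and is here regarded as a subset of
  the real line, with its Borel \<open>\<sigma>\<close>-algebra.\<close>

definition spectrum_borel :: "('a::complex_hilbert_space \<rightharpoonup> 'a) \<Rightarrow> real measure" where
  "spectrum_borel T = restrict_space borel {t. complex_of_real t \<in> spectrum T}"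


subsection \<open>Spectral measures\<close>

definition projection_valued_measure ::
    "'b measure \<Rightarrow> ('b set \<Rightarrow> 'a::complex_hilbert_space \<Rightarrow> 'a) \<Rightarrow> bool" where
  "projection_valued_measure \<Omega> E \<longleftrightarrow>
     (\<forall>A\<in>sets \<Omega>. orthogonal_projector (E A)) \<and>
     E (space \<Omega>) = id \<and>
     (\<forall>A\<in>sets \<Omega>. \<forall>B\<in>sets \<Omega>. E (A \<inter> B) = E A \<circ> E B) \<and>
     (\<forall>F :: nat \<Rightarrow> 'b set. range F \<subseteq> sets \<Omega> \<longrightarrow> disjoint_family F \<longrightarrow>
        (\<forall>x. (\<lambda>n. E (F n) x) sums E (\<Union>n. F n) x))"

text \<open>The finite measure \<open>A \<mapsto> \<langle>x, E(A) x\<rangle>\<close>.\<close>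

definition diagonal_measure ::
    "'b measure \<Rightarrow> ('b set \<Rightarrow> 'a::complex_hilbert_space \<Rightarrow> 'a) \<Rightarrow> 'a \<Rightarrow> 'b measure" where
  "diagonal_measure \<Omega> E x =
     measure_of (space \<Omega>) (sets \<Omega>) (\<lambda>A. ennreal (Re (cinner x (E A x))))"

text \<open>\<open>E\<close> is the spectral measure of \<open>T\<close>, i.e. \<open>T = \<integral> t dE(t)\<close>: the domain of \<open>T\<close> consists of
  the \<open>x\<close> with \<open>\<integral> t\<^sup>2 d\<langle>x, E(t) x\<rangle> < \<infinity>\<close>, and \<open>\<langle>x, T x\<rangle> = \<integral> t d\<langle>x, E(t) x\<rangle>\<close> for these \<open>x\<close>
  (which fixes \<open>T x\<close> by polarization).  By the spectral theorem every self-adjoint operator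
  has exactly one such \<open>E\<close> on the Borel sets of its spectrum.\<close>

definition spectral_measure ::
    "('a::complex_hilbert_space \<rightharpoonup> 'a) \<Rightarrow> (real set \<Rightarrow> 'a \<Rightarrow> 'a) \<Rightarrow> bool" where
  "spectral_measure T E \<longleftrightarrow>
     projection_valued_measure (spectrum_borel T) E \<and>
     dom T = {x. integrable (diagonal_measure (spectrum_borel T) E x) (\<lambda>t. t\<^sup>2)} \<and>
     (\<forall>x\<in>dom T. cinner x (the (T x)) =
        complex_of_real (\<integral>t. t \<partial>diagonal_measure (spectrum_borel T) E x))"

text \<open>Commutativity of (possibly unbounded) self-adjoint operators in the usual sense:
  all their spectral projectors commute.\<close>

definition operators_commute ::
    "('a::complex_hilbert_space \<rightharpoonup> 'a) \<Rightarrow> ('a \<rightharpoonup> 'a) \<Rightarrow> bool" where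
  "operators_commute S T \<longleftrightarrow>
     (\<forall>E F. spectral_measure S E \<longrightarrow> spectral_measure T F \<longrightarrow>
        (\<forall>A\<in>sets (spectrum_borel S). \<forall>B\<in>sets (spectrum_borel T). E A \<circ> F B = F B \<circ> E A))"


subsection \<open>Joint distributions of compatible measurements\<close>

text \<open>\<open>\<eta> :: 'n \<Rightarrow> bool\<close> encodes a vector in \<open>{0,1}\<^sup>N\<close> with \<open>N = CARD('n)\<close>.
  A family \<open>(A i)\<close> is constrained, and used, only at the indices \<open>i\<close> with \<open>\<eta> i\<close>.\<close>

definition borel_family ::
    "('n \<Rightarrow> 'a::complex_hilbert_space \<rightharpoonup> 'a) \<Rightarrow> ('n \<Rightarrow> bool) \<Rightarrow> ('n \<Rightarrow> real set) \<Rightarrow> bool" where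
  "borel_family M \<eta> A \<longleftrightarrow> (\<forall>i. \<eta> i \<longrightarrow> A i \<in> sets (spectrum_borel (M i)))"

definition outcome_event ::
    "('n \<Rightarrow> bool) \<Rightarrow> ('n \<Rightarrow> real set) \<Rightarrow> ('n \<Rightarrow> real) set" where
  "outcome_event \<eta> A = (\<Pi>\<^sub>E i\<in>{i. \<eta> i}. A i)"

text \<open>The composition of the projectors \<open>E i (A i)\<close> with \<open>\<eta> i\<close>; the fold is independent of
  the order of the factors when these commute.\<close>

definition projector_product ::
    "('n::finite \<Rightarrow> real set \<Rightarrow> 'a::complex_hilbert_space \<Rightarrow> 'a) \<Rightarrow>
     ('n \<Rightarrow> bool) \<Rightarrow> ('n \<Rightarrow> real set) \<Rightarrow> 'a \<Rightarrow> 'a" where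
  "projector_product E \<eta> A = Finite_Set.fold (\<lambda>i T. E i (A i) \<circ> T) id {i. \<eta> i}"

definition joint_distribution ::
    "('a::complex_hilbert_space \<Rightarrow> 'a) \<Rightarrow> ('n::finite \<Rightarrow> 'a \<rightharpoonup> 'a) \<Rightarrow>
     ('n \<Rightarrow> real set \<Rightarrow> 'a \<Rightarrow> 'a) \<Rightarrow> ('n \<Rightarrow> bool) \<Rightarrow> ('n \<Rightarrow> real) measure" where
  "joint_distribution W M E \<eta> = (THE \<mu>.
     prob_space \<mu> \<and>
     sets \<mu> = sets (\<Pi>\<^sub>M i\<in>{i. \<eta> i}. spectrum_borel (M i)) \<and>
     (\<forall>A. borel_family M \<eta> A \<longrightarrow>
        complex_of_real (measure \<mu> (outcome_event \<eta> A)) = operator_trace (W \<circ> projector_product E \<eta> A)))"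

end

theory Submission
  imports Defs
begin

text \<open>Everything reduces to joint distributions of commuting observables.  A density operator is
  a sum of rank-one operators given by vectors \<open>w\<^sub>n\<close>, so that \<open>tr (W Q) = \<Sum>\<^sub>n \<parallel>Q w\<^sub>n\<parallel>\<^sup>2\<close> for every
  projector \<open>Q\<close>.  Hence \<open>tr (W \<Prod>\<^sub>i E\<^sub>i(A\<^sub>i))\<close> is nonnegative and countably additive in each \<open>A\<^sub>i\<close>
  separately.  Coding real numbers by bit sequences turns such a function into a consistent family
  of probabilities of finite bit strings, which is realised by successively subdividing the unit
  interval.  The classical space is the mixture of the joint distributions, weighted by the
  probabilities of the conditions \<open>\<eta>\<close>, each placed on its own fibre.\<close>

subsection \<open>Inner products and Parseval's identity\<close>

text \<open>A set function on rectangles that is countably additive in each side need not extend to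
  a measure on the product in general; the extension rests on the sides being Borel sets of the
  line. Among bit sequences every generating event involves finitely many bits, so consistency of
  finite strings suffices and Lebesgue measure supplies the countable additivity. Decoding needs a
  Borel range with at least one point, which is why the spectrum is shown to be closed and nonempty.
  The trace is an unordered sum over one chosen, possibly uncountable orthonormal basis. Expanding
  \<open>W\<close> in vectors \<open>w n\<close> replaces it by a countable sum that no longer
  mentions the basis; positivity and countable additivity then come from exchanging sums of
  nonnegative terms. For \<eta> of probability 0 the projectors may fail to commute and no joint
  distribution need exist. The mixture puts a point mass on such a fibre, which has weight
  0.\<close>

lemma cinner_add_left: "cinner (x + y) (z::'a::complex_hilbert_space) = cinner x z + cinner y z"
  by (metis cinner_add_right cinner_commute complex_cnj_add)

lemma cinner_scaleC_left: "cinner (c *\<^sub>C x) (z::'a::complex_hilbert_space) = cnj c * cinner x z"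
  by (metis cinner_commute cinner_scaleC_right complex_cnj_mult)

lemma uminus_eq_scaleC: "- (x::'a::complex_hilbert_space) = (-1) *\<^sub>C x"
  using scaleR_eq_scaleC[of "-1" x] by simp

lemma cinner_minus_right [simp]: "cinner x (- y::'a::complex_hilbert_space) = - cinner x y"
  by (simp add: uminus_eq_scaleC cinner_scaleC_right)

lemma cinner_minus_left [simp]: "cinner (- x) (y::'a::complex_hilbert_space) = - cinner x y"
  by (simp add: uminus_eq_scaleC cinner_scaleC_left)

lemma cinner_diff_right: "cinner x (y - z::'a::complex_hilbert_space) = cinner x y - cinner x z"
  by (metis add_uminus_conv_diff cinner_add_right cinner_minus_right)

lemma cinner_diff_left: "cinner (x - y) (z::'a::complex_hilbert_space) = cinner x z - cinner y z"
  by (metis add_uminus_conv_diff cinner_add_left cinner_minus_left)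

lemma cinner_zero_right [simp]: "cinner (x::'a::complex_hilbert_space) 0 = 0"
  using cinner_diff_right[of x 0 0] by simp

lemma cinner_zero_left [simp]: "cinner 0 (x::'a::complex_hilbert_space) = 0"
  using cinner_diff_left[of 0 0 x] by simp

lemma cinner_sum_right: "cinner x (\<Sum>i\<in>F. f i :: 'a::complex_hilbert_space) = (\<Sum>i\<in>F. cinner x (f i))"
  by (induction F rule: infinite_finite_induct) (auto simp: cinner_add_right)

lemma cinner_sum_left: "cinner (\<Sum>i\<in>F. f i :: 'a::complex_hilbert_space) x = (\<Sum>i\<in>F. cinner (f i) x)"
  by (induction F rule: infinite_finite_induct) (auto simp: cinner_add_left)

lemma cinner_eq_zero_iff [simp]: "cinner x (x::'a::complex_hilbert_space) = 0 \<longleftrightarrow> x = 0"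
  by (simp add: cinner_same)

lemma cinner_ext: "(\<And>z. cinner z x = cinner z y) \<Longrightarrow> x = (y::'a::complex_hilbert_space)"
  by (metis cinner_diff_right cinner_eq_zero_iff eq_iff_diff_eq_0)

lemma zero_scaleC [simp]: "0 *\<^sub>C (x::'a::complex_hilbert_space) = 0"
  using scaleR_eq_scaleC[of 0 x] by simp

lemma one_scaleC [simp]: "1 *\<^sub>C (x::'a::complex_hilbert_space) = x"
  using scaleR_eq_scaleC[of 1 x] by simp

lemma norm_scaleC: "norm (c *\<^sub>C (x::'a::complex_hilbert_space)) = cmod c * norm x"
proof -
  have "complex_of_real ((norm (c *\<^sub>C x))\<^sup>2) = complex_of_real ((cmod c * norm x)\<^sup>2)"
    unfolding cinner_same[symmetric] cinner_scaleC_left cinner_scaleC_right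
    using complex_norm_square[of c] by (simp add: cinner_same power_mult_distrib)
  then show ?thesis
    by (metis of_real_eq_iff norm_ge_zero power2_eq_iff_nonneg mult_nonneg_nonneg)
qed

lemma cnj_mult_self: "cnj z * z = complex_of_real ((cmod z)\<^sup>2)"
  by (metis complex_norm_square mult.commute)

text \<open>Collects the algebraic properties that survive subtraction of a rank-one piece in
  \<open>deflate\<close> and that carry the Cauchy-Schwarz inequality. Symmetry is recorded as such
  rather than through real diagonal values.\<close>

definition positive_form :: "('a::complex_hilbert_space \<Rightarrow> 'a) \<Rightarrow> bool" where
  "positive_form V \<longleftrightarrow>
     (\<forall>x y. V (x + y) = V x + V y) \<and> (\<forall>c x. V (c *\<^sub>C x) = c *\<^sub>C V x) \<and>
     (\<forall>x y. cinner (V x) y = cinner x (V y)) \<and> (\<forall>x. 0 \<le> Re (cinner x (V x)))"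

lemma positive_formD:
  assumes "positive_form V"
  shows "V (x + y) = V x + V y" "V (c *\<^sub>C x) = c *\<^sub>C V x"
    "cinner (V x) y = cinner x (V y)" "0 \<le> Re (cinner x (V x))"
    "V (x - y) = V x - V y" "cinner x (V x) = complex_of_real (Re (cinner x (V x)))"
proof -
  show 1: "V (x + y) = V x + V y" "V (c *\<^sub>C x) = c *\<^sub>C V x"
    "cinner (V x) y = cinner x (V y)" "0 \<le> Re (cinner x (V x))" for x y c
    using assms by (auto simp: positive_form_def)
  show "V (x - y) = V x - V y"
    using 1(1)[of "x - y" y] by (simp add: algebra_simps)
  have "cnj (cinner x (V x)) = cinner x (V x)"
    by (metis 1(3) cinner_commute)
  then show "cinner x (V x) = complex_of_real (Re (cinner x (V x)))"
    by (simp add: complex_eq_iff)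
qed

text \<open>Expand \<open>\<langle>z, V z\<rangle> \<ge> 0\<close> at \<open>z = x - t \<langle>y, V x\<rangle> y\<close> for every real \<open>t\<close>, so that \<open>y\<close> with
  \<open>\<langle>y, V y\<rangle> = 0\<close> is covered as well.\<close>

lemma Cauchy_Schwarz_form:
  assumes V: "positive_form V"
  shows "(cmod (cinner y (V x)))\<^sup>2 \<le> Re (cinner x (V x)) * Re (cinner y (V y))"
proof -
  define a where "a = cinner y (V x)"
  define p where "p = Re (cinner x (V x))"
  define q where "q = Re (cinner y (V y))"
  note D = positive_formD[OF V]
  have a': "cinner x (V y) = cnj a"
    by (metis D(3) a_def cinner_commute)
  have pq: "cinner x (V x) = of_real p" "cinner y (V y) = of_real q" "p \<ge> 0" "q \<ge> 0"
    using D by (auto simp: p_def q_def)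
  have aa: "a * cnj a = of_real ((cmod a)\<^sup>2)"
    by (metis complex_norm_square of_real_power)
  have quad: "0 \<le> p - 2 * t * (cmod a)\<^sup>2 + t\<^sup>2 * (cmod a)\<^sup>2 * q" for t :: real
  proof -
    have "cinner (x - (of_real t * a) *\<^sub>C y) (V (x - (of_real t * a) *\<^sub>C y))
      = of_real p - 2 * of_real t * (a * cnj a) + (of_real t)\<^sup>2 * (a * cnj a) * of_real q"
      by (simp add: D(2,5) cinner_diff_left cinner_diff_right cinner_scaleC_left cinner_scaleC_right
          pq a' a_def[symmetric] algebra_simps power2_eq_square)
    also have "\<dots> = of_real (p - 2 * t * (cmod a)\<^sup>2 + t\<^sup>2 * (cmod a)\<^sup>2 * q)"
      by (simp add: aa)
    finally show ?thesis
      using D(4)[of "x - (of_real t * a) *\<^sub>C y"] by simp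
  qed
  show ?thesis
  proof (cases "q = 0")
    case True
    have "(cmod a)\<^sup>2 = 0"
    proof (rule ccontr)
      assume "(cmod a)\<^sup>2 \<noteq> 0"
      \<comment> \<open>With \<open>q = 0\<close> the quadratic is linear in \<open>t\<close>, and
        this \<open>t\<close> gives it the value -1.\<close>
      then have "2 * ((p + 1) / (2 * (cmod a)\<^sup>2)) * (cmod a)\<^sup>2 = p + 1" by (simp add: field_simps)
      with quad[of "(p + 1) / (2 * (cmod a)\<^sup>2)"] True show False by simp
    qed
    then show ?thesis unfolding a_def[symmetric] p_def[symmetric] q_def[symmetric] using True by simp
  next
    case False
    with pq have q: "q > 0" by simp
    \<comment> \<open>\<open>t = 1/q\<close> minimises the quadratic.\<close>
    have "0 \<le> p - 2 * (1/q) * (cmod a)\<^sup>2 + (1/q)\<^sup>2 * (cmod a)\<^sup>2 * q" by (rule quad)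
    also have "\<dots> = p - (cmod a)\<^sup>2 / q"
      using q by (simp add: power2_eq_square field_simps)
    finally have "(cmod a)\<^sup>2 \<le> p * q"
      using q by (simp add: field_simps)
    then show ?thesis by (simp add: a_def p_def q_def)
  qed
qed

section \<open>Bessel, Fourier expansion and Parseval in an arbitrary Hilbert space\<close>

lemma positive_form_id: "positive_form (\<lambda>x. x)"
  by (auto simp: positive_form_def cinner_same)

lemma Cauchy_Schwarz_cinner: "cmod (cinner x y) \<le> norm x * norm (y::'a::complex_hilbert_space)"
proof -
  have "(cmod (cinner x y))\<^sup>2 \<le> (norm x * norm y)\<^sup>2"
    using Cauchy_Schwarz_form[OF positive_form_id, of x y]
    by (simp add: cinner_same power_mult_distrib mult_ac)
  then show ?thesis by (rule power2_le_imp_le) simp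
qed

lemma bounded_linear_cinner_right: "bounded_linear (cinner (x::'a::complex_hilbert_space))"
proof (rule bounded_linear_intro[where K = "norm x"])
  show "cmod (cinner x y) \<le> norm y * norm x" for y
    using Cauchy_Schwarz_cinner[of x y] by (simp add: mult.commute)
qed (auto simp: cinner_add_right scaleR_eq_scaleC cinner_scaleC_right scaleR_conv_of_real)

text \<open>Bessel's equality. The partial Fourier sum \<open>s\<close> has the same coefficients as
  \<open>x\<close> on \<open>F\<close>, so \<open>cinner s x\<close>, \<open>cinner x s\<close> and
  \<open>cinner s s\<close> all equal the sum of the squared coefficients.\<close>

lemma norm_diff_sum_orthonormal:
  fixes x :: "'a::complex_hilbert_space"
  assumes "\<And>b c. b \<in> F \<Longrightarrow> c \<in> F \<Longrightarrow> cinner b c = (if b = c then 1 else 0)" "finite F"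
  shows "(norm (x - (\<Sum>b\<in>F. cinner b x *\<^sub>C b)))\<^sup>2 = (norm x)\<^sup>2 - (\<Sum>b\<in>F. (cmod (cinner b x))\<^sup>2)"
    and "(norm (\<Sum>b\<in>F. cinner b x *\<^sub>C b))\<^sup>2 = (\<Sum>b\<in>F. (cmod (cinner b x))\<^sup>2)"
proof -
  define s where "s = (\<Sum>b\<in>F. cinner b x *\<^sub>C b)"
  have bs: "cinner b s = cinner b x" if "b \<in> F" for b
  proof -
    have "cinner b s = (\<Sum>c\<in>F. if c = b then cinner b x else 0)"
      unfolding s_def cinner_sum_right cinner_scaleC_right using assms(1) that
      by (intro sum.cong) auto
    then show ?thesis using assms(2) that by simp
  qed
  have sx: "cinner s y = (\<Sum>b\<in>F. cnj (cinner b x) * cinner b y)" for y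
    by (simp add: s_def cinner_sum_left cinner_scaleC_left)
  have 1: "cinner s x = of_real (\<Sum>b\<in>F. (cmod (cinner b x))\<^sup>2)"
    unfolding sx cnj_mult_self by simp
  have 2: "cinner s s = of_real (\<Sum>b\<in>F. (cmod (cinner b x))\<^sup>2)"
    unfolding sx of_real_sum by (intro sum.cong refl) (simp only: bs cnj_mult_self)
  have 3: "cinner x s = of_real (\<Sum>b\<in>F. (cmod (cinner b x))\<^sup>2)"
    by (metis 1 cinner_commute complex_cnj_complex_of_real)
  have "complex_of_real ((norm (x - s))\<^sup>2) = of_real ((norm x)\<^sup>2 - (\<Sum>b\<in>F. (cmod (cinner b x))\<^sup>2))"
    unfolding cinner_same[symmetric] cinner_diff_left cinner_diff_right 1 2 3
    by (simp add: cinner_same)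
  then show "(norm (x - (\<Sum>b\<in>F. cinner b x *\<^sub>C b)))\<^sup>2 = (norm x)\<^sup>2 - (\<Sum>b\<in>F. (cmod (cinner b x))\<^sup>2)"
    unfolding s_def of_real_eq_iff .
  show "(norm (\<Sum>b\<in>F. cinner b x *\<^sub>C b))\<^sup>2 = (\<Sum>b\<in>F. (cmod (cinner b x))\<^sup>2)"
    using 2 unfolding cinner_same s_def of_real_eq_iff .
qed

text \<open>Bessel bounds the sums of squared coefficients, which makes the partial Fourier sums a
  Cauchy filter. The limit has the same coefficients as \<open>x\<close>, hence equals
  \<open>x\<close> by totality of \<open>B\<close>.\<close>

lemma has_sum_orthonormal_basis:
  fixes x :: "'a::complex_hilbert_space"
  assumes B: "orthonormal_basis B"
  shows "((\<lambda>b. cinner b x *\<^sub>C b) has_sum x) B"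
proof -
  have on: "\<And>b c. b \<in> B \<Longrightarrow> c \<in> B \<Longrightarrow> cinner b c = (if b = c then 1 else 0)"
    and tot: "\<And>x. (\<And>b. b \<in> B \<Longrightarrow> cinner b x = 0) \<Longrightarrow> x = 0"
    using B by (auto simp: orthonormal_basis_def)
  define g where "g = (\<lambda>b. (cmod (cinner b x))\<^sup>2)"
  define f where "f = (\<lambda>b. cinner b x *\<^sub>C b)"
  have normf: "(norm (sum f F))\<^sup>2 = sum g F" "sum g F \<le> (norm x)\<^sup>2" if "finite F" "F \<subseteq> B" for F
    using norm_diff_sum_orthonormal[of F x] on that
      zero_le_power2[of "norm (x - (\<Sum>b\<in>F. cinner b x *\<^sub>C b))"]
    by (auto simp: f_def g_def subset_iff)
  have "g summable_on B"
  proof (rule nonneg_bounded_partial_sums_imp_summable_on[where C = "(norm x)\<^sup>2"])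
    show "\<forall>\<^sub>F F in finite_subsets_at_top B. sum g F \<le> (norm x)\<^sup>2"
      by (intro eventually_finite_subsets_at_top_weakI normf)
  qed (simp add: g_def)
  then obtain s where s: "(g has_sum s) B" by (auto simp: summable_on_def)
  have "cauchy_filter (filtermap (sum f) (finite_subsets_at_top B))"
    unfolding cauchy_filter_metric
  proof (intro allI impI)
    fix e :: real assume e: "e > 0"
    \<comment> \<open>Two partial sums of \<open>g\<close> within \<open>e\<^sup>2 / 8\<close> of
      the limit differ by less than \<open>(e/2)\<^sup>2\<close>, so Fourier sums beyond
      \<open>X\<close> stay within \<open>e/2\<close> of the one at \<open>X\<close>.\<close>
    then have "e\<^sup>2 / 8 > 0" by simp
    then have "eventually (\<lambda>F. dist (sum g F) s < e\<^sup>2 / 8) (finite_subsets_at_top B)"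
      using s unfolding has_sum_def tendsto_iff by blast
    then obtain X where "finite X \<and> X \<subseteq> B \<and>
        (\<forall>Y. finite Y \<and> X \<subseteq> Y \<and> Y \<subseteq> B \<longrightarrow> dist (sum g Y) s < e\<^sup>2 / 8)"
      unfolding eventually_finite_subsets_at_top by (rule exE)
    then have X: "finite X" "X \<subseteq> B"
        "\<And>Y. finite Y \<Longrightarrow> X \<subseteq> Y \<Longrightarrow> Y \<subseteq> B \<Longrightarrow> dist (sum g Y) s < e\<^sup>2 / 8"
      by simp_all
    have close: "dist (sum f Y) (sum f X) < e / 2" if Y: "finite Y" "X \<subseteq> Y" "Y \<subseteq> B" for Y
    proof -
      have "sum f Y - sum f X = sum f (Y - X)" and sg: "sum g Y - sum g X = sum g (Y - X)"
        using Y X(1) by (auto simp: sum_diff)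
      then have "(norm (sum f Y - sum f X))\<^sup>2 = sum g Y - sum g X"
        using normf(1)[of "Y - X"] Y by auto
      also have "\<dots> < e\<^sup>2 / 4"
        using X(3)[OF Y] X(3)[OF X(1) subset_refl X(2)] unfolding dist_real_def by linarith
      finally have "(norm (sum f Y - sum f X))\<^sup>2 < (e/2)\<^sup>2"
        by (simp add: power_divide)
      then have "norm (sum f Y - sum f X) < e / 2"
        by (rule power2_less_imp_less) (use e in simp)
      then show ?thesis by (simp add: dist_norm)
    qed
    have "dist y z < e" if "y \<in> ball (sum f X) (e/2)" "z \<in> ball (sum f X) (e/2)" for y z
      using that dist_triangle_half_r[of "sum f X" y e z] by simp
    moreover have "eventually (\<lambda>y. y \<in> ball (sum f X) (e/2)) (filtermap (sum f) (finite_subsets_at_top B))"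
      unfolding eventually_filtermap eventually_finite_subsets_at_top
    proof (intro exI[of _ X] conjI allI impI)
      fix Y assume "finite Y \<and> X \<subseteq> Y \<and> Y \<subseteq> B"
      then show "sum f Y \<in> ball (sum f X) (e/2)"
        using close[of Y] by (simp add: dist_commute)
    qed (use X in auto)
    ultimately show "\<exists>P. eventually P (filtermap (sum f) (finite_subsets_at_top B)) \<and>
        (\<forall>x y. P x \<and> P y \<longrightarrow> dist x y < e)"
      by (intro exI[of _ "\<lambda>y. y \<in> ball (sum f X) (e/2)"]) simp
  qed
  then have "convergent_filter (filtermap (sum f) (finite_subsets_at_top B))"
    by (rule cauchy_filter_convergent)
  then obtain v where v: "(f has_sum v) B"
    unfolding convergent_filter_iff has_sum_def filterlim_def by (rule exE)
  have "cinner b (x - v) = 0" if b: "b \<in> B" for b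
  proof -
    have "((\<lambda>c. cinner b (f c)) has_sum cinner b v) B"
      using has_sum_bounded_linear[OF bounded_linear_cinner_right v] .
    moreover have "((\<lambda>c. cinner b (f c)) has_sum cinner b x) B"
    proof (rule has_sum_finite_neutralI[where B = "{b}"])
      show "cinner b x = (\<Sum>c\<in>{b}. cinner b (f c))" using on b by (simp add: f_def cinner_scaleC_right)
    qed (use on b in \<open>auto simp: f_def cinner_scaleC_right\<close>)
    ultimately have "cinner b v = cinner b x" by (rule has_sum_unique)
    then show ?thesis by (simp add: cinner_diff_right)
  qed
  then have "v = x" using tot[of "x - v"] by simp
  with v show ?thesis by (simp add: f_def)
qed

lemma Parseval:
  fixes x y :: "'a::complex_hilbert_space"
  assumes "orthonormal_basis B"
  shows "((\<lambda>b. cinner x b * cinner b y) has_sum cinner x y) B"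
  using has_sum_bounded_linear[OF bounded_linear_cinner_right[of x] has_sum_orthonormal_basis[OF assms, of y]]
  by (simp add: cinner_scaleC_right mult.commute)

lemma Parseval_norm:
  fixes x :: "'a::complex_hilbert_space"
  assumes "orthonormal_basis B"
  shows "((\<lambda>b. (cmod (cinner b x))\<^sup>2) has_sum (norm x)\<^sup>2) B"
proof -
  have "cinner x b * cinner b x = of_real ((cmod (cinner b x))\<^sup>2)" for b
    by (metis cinner_commute complex_norm_square mult.commute)
  then show ?thesis
    using Parseval[OF assms, of x x] unfolding cinner_same by (simp only: has_sum_of_real_iff)
qed

text \<open>Zorn's lemma gives a maximal orthonormal set; a nonzero vector orthogonal to it could be
  normalised and added.\<close>

lemma orthonormal_basis_exists: "\<exists>B::'a::complex_hilbert_space set. orthonormal_basis B"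
proof -
  define on where "on = {B::'a set. \<forall>b\<in>B. \<forall>c\<in>B. cinner b c = (if b = c then 1 else 0)}"
  have "\<exists>M\<in>on. \<forall>X\<in>on. M \<subseteq> X \<longrightarrow> X = M"
  proof (rule subset_Zorn')
    fix C assume C: "subset.chain on C"
    show "\<Union>C \<in> on"
      unfolding on_def
    proof safe
      fix b c X Y assume *: "b \<in> X" "X \<in> C" "c \<in> Y" "Y \<in> C"
      then have "X \<subseteq> Y \<or> Y \<subseteq> X" "X \<in> on" "Y \<in> on" using C by (auto simp: subset_chain_def)
      with * show "cinner b c = (if b = c then 1 else 0)" by (auto simp: on_def)
    qed
  qed
  then obtain B where B: "B \<in> on" "\<And>X. X \<in> on \<Longrightarrow> B \<subseteq> X \<Longrightarrow> X = B" by blast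
  have "x = 0" if x: "\<forall>b\<in>B. cinner b x = 0" for x
  proof (rule ccontr)
    assume nz: "x \<noteq> 0"
    define u where "u = complex_of_real (1 / norm x) *\<^sub>C x"
    have u: "cinner u u = 1" using nz
      by (simp add: cinner_same u_def norm_scaleC norm_divide)
    have bu: "cinner b u = 0" "cinner u b = 0" if "b \<in> B" for b
    proof -
      show "cinner b u = 0" using x that by (simp add: u_def cinner_scaleC_right)
      then show "cinner u b = 0" by (metis cinner_commute complex_cnj_zero)
    qed
    have "u \<notin> B" using bu(1)[of u] u by auto
    have "cinner b c = (if b = c then 1 else 0)" if "b \<in> insert u B" "c \<in> insert u B" for b c
      using that B(1) u bu \<open>u \<notin> B\<close> by (cases "b = u"; cases "c = u") (auto simp: on_def)
    then have "insert u B \<in> on" unfolding on_def by blast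
    then have "u \<in> B" using B(2)[of "insert u B"] by blast
    with \<open>u \<notin> B\<close> show False by simp
  qed
  then have "orthonormal_basis B"
    using B(1) unfolding orthonormal_basis_def on_def by blast
  then show ?thesis by (rule exI)
qed

subsection \<open>Decomposition of a density operator into rank-one operators\<close>

text \<open>Scaled so that the rank-one operator of this vector agrees with \<open>V\<close> at
  \<open>b\<close>. If \<open>cinner b (V b)\<close> vanishes, division by 0 makes it the zero
  vector.\<close>

definition deflation_vector ::
    "('a::complex_hilbert_space \<Rightarrow> 'a) \<Rightarrow> 'a \<Rightarrow> 'a" where
  "deflation_vector V b = complex_of_real (1 / sqrt (Re (cinner b (V b)))) *\<^sub>C V b"

text \<open>The Schur complement of \<open>V\<close> with respect to \<open>b\<close>: one step of
  Gaussian elimination.\<close>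

definition deflate ::
    "('a::complex_hilbert_space \<Rightarrow> 'a) \<Rightarrow> 'a \<Rightarrow> 'a \<Rightarrow> 'a" where
  "deflate V b x = V x - cinner (deflation_vector V b) x *\<^sub>C deflation_vector V b"

text \<open>Cauchy-Schwarz for the vectors \<open>V b\<close> and \<open>b\<close> bounds the fourth
  power of the norm of \<open>V b\<close> by a multiple of \<open>cinner b (V b)\<close>.\<close>

lemma positive_form_eq_0:
  assumes V: "positive_form V" and "Re (cinner b (V b)) = 0"
  shows "V b = 0"
  using Cauchy_Schwarz_form[OF V, of "V b" b] assms(2)
  by (simp add: positive_formD(3)[OF V, symmetric] flip: cinner_eq_zero_iff)

text \<open>Nonnegativity of the remainder is Cauchy-Schwarz for the form: the subtracted term is
  the squared modulus of \<open>cinner x (V b)\<close> divided by \<open>cinner b (V b)\<close>,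
  which is at most \<open>cinner x (V x)\<close>.\<close>

lemma positive_form_deflate:
  assumes V: "positive_form V"
  shows "positive_form (deflate V b)"
proof -
  note D = positive_formD[OF V]
  define w where "w = deflation_vector V b"
  define q where "q = Re (cinner b (V b))"
  have q: "q \<ge> 0" using D(4) by (simp add: q_def)
  have step: "deflate V b x = V x - cinner w x *\<^sub>C w" for x
    by (simp add: deflate_def w_def)
  have form: "cinner x (deflate V b y) = cinner x (V y) - cinner w y * cinner x w" for x y
    by (simp add: step cinner_diff_right cinner_scaleC_right)
  have form': "cinner (deflate V b x) y = cinner (V x) y - cinner x w * cinner w y" for x y
    unfolding step cinner_diff_left cinner_scaleC_left by (metis cinner_commute)
  have "(cmod (cinner x w))\<^sup>2 \<le> Re (cinner x (V x))" for x
  proof (cases "q = 0")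
    case True
    then show ?thesis using D(4)[of x] by (simp add: w_def deflation_vector_def q_def)
  next
    case False
    have "(cmod (cinner x w))\<^sup>2 = (cmod (cinner x (V b)))\<^sup>2 / q"
      using q by (simp add: w_def deflation_vector_def cinner_scaleC_right q_def[symmetric]
          norm_mult norm_divide power_mult_distrib power_divide)
    also have "\<dots> \<le> Re (cinner x (V x))"
      using Cauchy_Schwarz_form[OF V, of x b] False q
      by (simp add: q_def[symmetric] field_simps)
    finally show ?thesis .
  qed
  moreover have "cinner w x * cinner x w = of_real ((cmod (cinner x w))\<^sup>2)" for x
    by (metis cinner_commute cnj_mult_self)
  ultimately have "0 \<le> Re (cinner x (deflate V b x))" for x
    by (simp add: form del: of_real_power)
  moreover have "deflate V b (x + y) = deflate V b x + deflate V b y" for x y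
    by (rule cinner_ext) (simp add: form D cinner_add_right algebra_simps)
  moreover have "deflate V b (c *\<^sub>C x) = c *\<^sub>C deflate V b x" for c x
    by (rule cinner_ext) (simp add: form D cinner_scaleC_right algebra_simps)
  moreover have "cinner (deflate V b x) y = cinner x (deflate V b y)" for x y
    by (simp add: form form' D mult.commute)
  ultimately show ?thesis by (simp add: positive_form_def)
qed

lemma deflate_self: "positive_form V \<Longrightarrow> deflate V b b = 0"
proof (cases "Re (cinner b (V b)) = 0")
  case True
  moreover assume "positive_form V"
  ultimately show ?thesis
    using positive_form_eq_0[of V b] by (simp add: deflate_def deflation_vector_def)
next
  case False
  assume V: "positive_form V"
  define q where "q = Re (cinner b (V b))"
  have q: "q > 0" using positive_formD(4)[OF V, of b] False by (simp add: q_def)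
  have b: "cinner (V b) b = of_real q"
    using positive_formD(3)[OF V, of b b] positive_formD(6)[OF V, of b] by (simp add: q_def)
  have "cinner (deflation_vector V b) b = of_real (1 / sqrt q) * of_real q"
    by (simp add: deflation_vector_def cinner_scaleC_left b q_def[symmetric])
  then have "cinner (deflation_vector V b) b *\<^sub>C deflation_vector V b
      = (of_real (1 / sqrt q) * of_real q * of_real (1 / sqrt q)) *\<^sub>C V b"
    by (simp add: deflation_vector_def scaleC_scaleC q_def[symmetric])
  also have "of_real (1 / sqrt q) * of_real q * of_real (1 / sqrt q) = complex_of_real (1 / sqrt q * q * (1 / sqrt q))"
    by (simp only: of_real_mult)
  also have "1 / sqrt q * q * (1 / sqrt q) = 1"
    using q by (simp add: field_simps)
  finally show ?thesis by (simp add: deflate_def)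
qed

text \<open>Zeros persist, since by symmetry \<open>cinner (V b) x = cinner b (V x)\<close>. Later
  deflations therefore neither undo earlier ones nor produce vectors with a component along
  \<open>x\<close>.\<close>

lemma deflate_eq_0:
  assumes V: "positive_form V" and x: "V x = 0"
  shows "cinner (deflation_vector V b) x = 0" "deflate V b x = 0"
proof -
  show "cinner (deflation_vector V b) x = 0"
    using x by (simp add: deflation_vector_def cinner_scaleC_left positive_formD(3)[OF V])
  then show "deflate V b x = 0" using x by (simp add: deflate_def)
qed

text \<open>Deflating \<open>W\<close> successively by the countably many basis vectors \<open>b\<close> with \<open>W b \<noteq> 0\<close> is an
  operator version of the Cholesky decomposition; on each basis vector it stops after finitely
  many steps, so that no square root of \<open>W\<close> is needed.\<close>

lemma positive_form_decomposition:
  assumes W: "positive_form W" and C: "countable {b\<in>B. Re (cinner b (W b)) \<noteq> 0}"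
  obtains w :: "nat \<Rightarrow> 'a::complex_hilbert_space"
  where "\<And>b. b \<in> B \<Longrightarrow> \<exists>m. (\<forall>n\<ge>m. cinner (w n) b = 0) \<and> W b = (\<Sum>n<m. cinner (w n) b *\<^sub>C w n)"
proof -
  define C where "C = {b\<in>B. Re (cinner b (W b)) \<noteq> 0}"
  \<comment> \<open>For finite or empty \<open>C\<close> this repeats elements or returns arbitrary
    vectors. The extra deflations are harmless because zeros already reached persist.\<close>
  define c where "c = from_nat_into C"
  define V where "V = rec_nat W (\<lambda>n U. deflate U (c n))"
  have V_0: "V 0 = W" and V_Suc: "V (Suc n) = deflate (V n) (c n)" for n
    by (auto simp: V_def)
  define w where "w n = deflation_vector (V n) (c n)" for n
  have pos: "positive_form (V n)" for n
    by (induction n) (auto simp: V_0 V_Suc W positive_form_deflate)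
  have zero: "V m x = 0" if "V n x = 0" "n \<le> m" for n m x
    using that(2)
  proof (induction m rule: dec_induct)
    case base
    show ?case by fact
  next
    case (step k)
    then show ?case by (simp add: V_Suc deflate_eq_0[OF pos])
  qed
  have decomp: "W x = (\<Sum>n<m. cinner (w n) x *\<^sub>C w n) + V m x" for m x
    by (induction m) (simp_all add: V_0 V_Suc deflate_def w_def)
  have "\<exists>m. (\<forall>n\<ge>m. cinner (w n) b = 0) \<and> W b = (\<Sum>n<m. cinner (w n) b *\<^sub>C w n)" if b: "b \<in> B" for b
  proof -
    have "\<exists>m. V m b = 0"
    proof (cases "b \<in> C")
      case True
      then obtain n where "c n = b"
        using C from_nat_into_surj[of C b] by (auto simp: C_def c_def)
      then have "V (Suc n) b = 0" by (metis V_Suc deflate_self pos)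
      then show ?thesis ..
    next
      case False
      then have "V 0 b = 0" using b positive_form_eq_0[OF W] by (simp add: C_def V_0)
      then show ?thesis ..
    qed
    then obtain m where m: "V m b = 0" by blast
    then have "\<forall>n\<ge>m. cinner (w n) b = 0"
      by (auto simp: w_def intro!: deflate_eq_0(1)[OF pos] zero[of m])
    moreover have "W b = (\<Sum>n<m. cinner (w n) b *\<^sub>C w n)"
      using decomp[of b m] m by simp
    ultimately show ?thesis by blast
  qed
  then show ?thesis by (rule that)
qed

section \<open>Traces against a density operator as countable sums\<close>

lemma bounded_clinearD:
  assumes "bounded_clinear T"
  shows "T (x + y) = T x + T y" "T (c *\<^sub>C x) = c *\<^sub>C T x" "bounded_linear T"
  using assms by (auto simp: bounded_clinear_def linear_simps)

text \<open>Polarization: the sesquilinear form \<open>h\<close> measures the failure of symmetry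
  and vanishes on the diagonal; evaluating it at \<open>x + y\<close> and at
  \<open>x + \<i> *\<^sub>C y\<close> forces \<open>h x y = 0\<close>.\<close>

lemma positive_form_positive_operator:
  assumes W: "bounded_clinear W" "positive_operator W"
  shows "positive_form W"
proof -
  note L = bounded_clinearD[OF W(1)]
  define h where "h x y = cinner x (W y) - cinner (W x) y" for x y
  have h0: "h x x = 0" for x
  proof -
    have "cinner x (W x) \<in> \<real>" using W(2) by (simp add: positive_operator_def)
    then have "cnj (cinner x (W x)) = cinner x (W x)" by (simp add: Reals_cnj_iff)
    then show ?thesis unfolding h_def by (metis cinner_commute right_minus_eq)
  qed
  have h_add: "h (x + y) z = h x z + h y z" "h z (x + y) = h z x + h z y" for x y z
    by (simp_all add: h_def L cinner_add_left cinner_add_right)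
  have h_scale: "h (c *\<^sub>C x) z = cnj c * h x z" "h z (c *\<^sub>C x) = c * h z x" for c x z
    by (simp_all add: h_def L cinner_scaleC_left cinner_scaleC_right right_diff_distrib)
  have "h x y = 0" for x y
  proof -
    have sum0: "h x y + h y x = 0"
      using h0[of "x + y"] h0[of x] h0[of y] by (simp add: h_add add.commute)
    have "\<i> * h x y - \<i> * h y x = 0"
      using h0[of "x + \<i> *\<^sub>C y"] h0[of x] h0[of y] by (simp add: h_add h_scale)
    then have "h x y = h y x" by simp
    with sum0 show ?thesis by simp
  qed
  then show ?thesis
    using W(2) by (simp add: positive_form_def positive_operator_def L h_def)
qed

lemma has_sum_double_swap:
  fixes f :: "'a \<Rightarrow> 'b \<Rightarrow> 'c::banach"
  assumes "(\<lambda>(x, y). f x y) summable_on A \<times> B"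
    and "\<And>x. x \<in> A \<Longrightarrow> (f x has_sum g x) B" "\<And>y. y \<in> B \<Longrightarrow> ((\<lambda>x. f x y) has_sum h y) A"
    and "(g has_sum s) A"
  shows "(h has_sum s) B"
proof -
  have "((\<lambda>(x, y). f x y) has_sum s) (A \<times> B)"
    using assms by (intro has_sum_SigmaI[where g = g]) auto
  then have "((\<lambda>(y, x). f x y) has_sum s) (B \<times> A)"
    by (subst (asm) has_sum_swap) simp
  then show ?thesis
    by (rule has_sum_SigmaD) (simp add: assms(3))
qed

text \<open>The array \<open>cinner (w n) (Q b) * cinner b (w n)\<close> is summed in two ways. Over
  \<open>n\<close> it gives \<open>cinner b (W (Q b))\<close> by the expansion of \<open>W\<close>;
  over \<open>b\<close> it gives \<open>cinner (w n) (Q (w n))\<close> by Parseval. The first claim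
  is the same computation with the identity in place of \<open>Q\<close>.\<close>

lemma density_operator_decomposition:
  fixes W :: "'a::complex_hilbert_space \<Rightarrow> 'a"
  assumes "density_operator W"
  obtains w :: "nat \<Rightarrow> 'a"
  where "((\<lambda>n. (norm (w n))\<^sup>2) has_sum 1) UNIV"
    and "\<And>Q. orthogonal_projector Q \<Longrightarrow> ((\<lambda>n. cinner (w n) (Q (w n))) has_sum operator_trace (W \<circ> Q)) UNIV"
proof -
  define B where "B = (SOME B::'a set. orthonormal_basis B)"
  have B: "orthonormal_basis B"
    unfolding B_def using orthonormal_basis_exists by (rule someI_ex)
  have tr: "operator_trace T = (\<Sum>\<^sub>\<infinity>b\<in>B. cinner b (T b))" for T :: "'a \<Rightarrow> 'a"
    by (simp add: operator_trace_def B_def)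
  have W: "positive_form W" and "operator_trace W = 1"
    using assms by (auto simp: density_operator_def intro: positive_form_positive_operator)
  \<comment> \<open>A sum that does not exist has the default value 0, so the value 1 certifies
    convergence.\<close>
  then have "((\<lambda>b. cinner b (W b)) has_sum 1) B"
    unfolding tr by (metis has_sum_infsum infsum_not_exists zero_neq_one)
  then have "((\<lambda>b. complex_of_real (Re (cinner b (W b)))) has_sum of_real 1) B"
    using positive_formD(6)[OF W] by simp
  then have trW: "((\<lambda>b. Re (cinner b (W b))) has_sum 1) B"
    by (simp only: has_sum_of_real_iff)
  \<comment> \<open>A summable family has countable support; this confines deflation to countably
    many members of a basis of any size.\<close>
  then have "countable {b\<in>B. Re (cinner b (W b)) \<noteq> 0}"
    by (intro abs_summable_countable) (auto simp: summable_on_def positive_formD(4)[OF W])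
  then obtain w :: "nat \<Rightarrow> 'a" where
    w: "\<And>b. b \<in> B \<Longrightarrow> \<exists>m. (\<forall>n\<ge>m. cinner (w n) b = 0) \<and> W b = (\<Sum>n<m. cinner (w n) b *\<^sub>C w n)"
    using positive_form_decomposition[OF W, of B] by blast
  \<comment> \<open>Symmetry moves \<open>W\<close> onto the basis vector \<open>b\<close>, where
    the expansion is a finite sum; \<open>y\<close> stays arbitrary, so that \<open>Q b\<close> can
    be inserted later.\<close>
  have row: "((\<lambda>n. cnj (cinner (w n) b) * cinner (w n) y) has_sum cinner b (W y)) UNIV"
    if b: "b \<in> B" for b y
  proof -
    obtain m where m: "\<And>n. n \<ge> m \<Longrightarrow> cinner (w n) b = 0" "W b = (\<Sum>n<m. cinner (w n) b *\<^sub>C w n)"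
      using w[OF b] by blast
    have "cinner b (W y) = cinner (W b) y" by (simp add: positive_formD(3)[OF W])
    also have "\<dots> = (\<Sum>n<m. cnj (cinner (w n) b) * cinner (w n) y)"
      by (simp add: m(2) cinner_sum_left cinner_scaleC_left)
    finally show ?thesis
      by (intro has_sum_finite_neutralI[where B = "{..<m}"]) (auto simp: m(1))
  qed
  have row2: "((\<lambda>n. (cmod (cinner b (w n)))\<^sup>2) has_sum Re (cinner b (W b))) UNIV" if "b \<in> B" for b
  proof -
    have "cmod (cinner b (w n)) = cmod (cinner (w n) b)" for n
      by (metis cinner_commute complex_mod_cnj)
    then show ?thesis
      using has_sum_Re[OF row[OF that, of b]] by (simp add: cnj_mult_self)
  qed
  have summ: "(\<lambda>(b, n). (cmod (cinner b (w n)))\<^sup>2) summable_on B \<times> UNIV"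
    using trW row2 by (intro summable_on_SigmaI[where g = "\<lambda>b. Re (cinner b (W b))"])
      (auto simp: summable_on_def)
  have w1: "((\<lambda>n. (norm (w n))\<^sup>2) has_sum 1) UNIV"
    using summ row2 Parseval_norm[OF B] trW by (rule has_sum_double_swap)
  have "((\<lambda>n. cinner (w n) (Q (w n))) has_sum operator_trace (W \<circ> Q)) UNIV"
    if Q: "orthogonal_projector Q" for Q
  proof -
    have sym: "cinner (Q x) y = cinner x (Q y)" and idem: "Q (Q x) = Q x" for x y
      using Q by (auto simp: orthogonal_projector_def fun_eq_iff)
    have le: "(norm (Q x))\<^sup>2 \<le> (norm x)\<^sup>2" for x
    proof -
      have "(norm (Q x))\<^sup>2 = Re (cinner x (Q x))"
        using cinner_same[of "Q x"] by (simp add: sym idem complex_eq_iff)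
      also have "\<dots> \<le> norm x * norm (Q x)"
        using Cauchy_Schwarz_cinner[of x "Q x"] complex_Re_le_cmod order_trans by blast
      finally have "norm (Q x) \<le> norm x"
        by (cases "norm (Q x) = 0") (auto simp: power2_eq_square)
      then show ?thesis by (simp add: power_mono)
    qed
    have "(\<lambda>(n, b). (cmod (cinner b (Q (w n))))\<^sup>2) summable_on UNIV \<times> B"
    proof (rule summable_on_SigmaI)
      show "((\<lambda>b. case (n, b) of (n, b) \<Rightarrow> (cmod (cinner b (Q (w n))))\<^sup>2) has_sum (norm (Q (w n)))\<^sup>2) B" for n
        using Parseval_norm[OF B] by simp
      show "(\<lambda>n. (norm (Q (w n)))\<^sup>2) summable_on UNIV"
        by (rule summable_on_comparison_test[OF has_sum_imp_summable[OF w1]]) (auto simp: le)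
    qed auto
    then have "(\<lambda>(b, n). (cmod (cinner b (Q (w n))))\<^sup>2) summable_on B \<times> UNIV"
      by (subst (asm) summable_on_swap) simp
    \<comment> \<open>Both families of squares are summable, and
      \<open>2 * s * t \<le> s\<^sup>2 + t\<^sup>2\<close> dominates each product. This joint
      summability licenses the exchange of \<open>n\<close> and \<open>b\<close>.\<close>
    from summable_on_add[OF this summ]
    have "(\<lambda>(b, n). (cmod (cinner b (Q (w n))))\<^sup>2 + (cmod (cinner b (w n)))\<^sup>2) summable_on B \<times> UNIV"
      by (simp add: case_prod_unfold)
    then have "(\<lambda>p. norm (case p of (b, n) \<Rightarrow> cinner (w n) (Q b) * cinner b (w n))) summable_on B \<times> UNIV"
    proof (rule summable_on_comparison_test)
      fix p :: "'a \<times> nat"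
      obtain b n where p: "p = (b, n)" by (cases p)
      have "cmod (cinner (w n) (Q b)) = cmod (cinner b (Q (w n)))"
        by (metis cinner_commute complex_mod_cnj sym)
      then have "norm (case p of (b, n) \<Rightarrow> cinner (w n) (Q b) * cinner b (w n))
          = cmod (cinner b (Q (w n))) * cmod (cinner b (w n))"
        by (simp add: p norm_mult)
      also have "\<dots> \<le> 2 * cmod (cinner b (Q (w n))) * cmod (cinner b (w n))"
        by simp
      also note sum_squares_bound
      finally show "norm (case p of (b, n) \<Rightarrow> cinner (w n) (Q b) * cinner b (w n))
          \<le> (case p of (b, n) \<Rightarrow> (cmod (cinner b (Q (w n))))\<^sup>2 + (cmod (cinner b (w n)))\<^sup>2)"
        by (simp add: p)
    qed auto
    then have summ': "(\<lambda>(b, n). cinner (w n) (Q b) * cinner b (w n)) summable_on B \<times> UNIV"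
      by (rule abs_summable_summable)
    have row': "((\<lambda>n. cinner (w n) (Q b) * cinner b (w n)) has_sum cinner b (W (Q b))) UNIV"
      if "b \<in> B" for b
      using row[OF that, of "Q b"] by (simp add: mult.commute flip: cinner_commute)
    have col': "((\<lambda>b. cinner (w n) (Q b) * cinner b (w n)) has_sum cinner (w n) (Q (w n))) B" for n
      using Parseval[OF B, of "Q (w n)" "w n"] by (simp add: sym)
    have "(\<lambda>b. cinner b (W (Q b))) summable_on B"
      using summable_on_Sigma_banach[OF summ']
        infsumI[OF row'] by (simp cong: summable_on_cong)
    then have "((\<lambda>b. cinner b (W (Q b))) has_sum operator_trace (W \<circ> Q)) B"
      unfolding tr comp_def by (rule has_sum_infsum)
    with summ' row' col' show ?thesis by (rule has_sum_double_swap)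
  qed
  with w1 show ?thesis by (rule that)
qed

subsection \<open>The spectrum\<close>

text \<open>Inverts \<open>1 - c R\<close> by Banach's fixed point theorem: the map sending
  \<open>u\<close> to \<open>y + c R u\<close> contracts with factor 1/2. Uniqueness of the fixed
  point makes \<open>U\<close> linear.\<close>

lemma bounded_clinear_resolvent_perturbation:
  fixes R :: "'a::complex_hilbert_space \<Rightarrow> 'a"
  assumes R: "bounded_clinear R" and K: "\<And>x. norm (R x) \<le> norm x * K" and c: "cmod c * K \<le> 1 / 2"
  obtains U where "bounded_clinear U" "\<And>y u. U y = u \<longleftrightarrow> u - c *\<^sub>C R u = y"
proof -
  note L = bounded_clinearD[OF R]
  define f where "f y u = y + c *\<^sub>C R u" for y u
  have cR: "norm (c *\<^sub>C R x) \<le> 1 / 2 * norm x" for x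
  proof -
    have "norm (c *\<^sub>C R x) \<le> cmod c * (norm x * K)"
      unfolding norm_scaleC by (intro mult_left_mono K) simp
    also have "\<dots> \<le> 1 / 2 * norm x"
      using mult_right_mono[OF c, of "norm x"] by (simp add: mult_ac)
    finally show ?thesis .
  qed
  have diff: "f y u - f y v = c *\<^sub>C R (u - v)" for y u v
  proof -
    have "f y u = f y v + c *\<^sub>C R (u - v)"
      unfolding f_def add.assoc scaleC_add_right[symmetric] L(1)[symmetric] by simp
    then show ?thesis by simp
  qed
  have ex1: "\<exists>!u. f y u = u" for y
    by (rule banach_fix_type[where c = "1 / 2"]) (use cR in \<open>auto simp: dist_norm diff\<close>)
  define U where "U y = (THE u. f y u = u)" for y
  have U: "U y = u \<longleftrightarrow> f y u = u" for y u
    using ex1[of y] theI'[OF ex1[of y]] unfolding U_def by blast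
  have fU: "y + c *\<^sub>C R (U y) = U y" for y
    using U[of y "U y"] by (simp add: f_def)
  have "bounded_clinear U"
    unfolding bounded_clinear_def
  proof (intro conjI allI)
    have add: "U (x + y) = U x + U y" for x y
      using fU[of x] fU[of y] unfolding U f_def L scaleC_add_right by (metis (no_types, lifting) add.assoc add.left_commute)
    show scale: "U (a *\<^sub>C x) = a *\<^sub>C U x" for a x
      using arg_cong[OF fU[of x], of "scaleC a"]
      unfolding U f_def L scaleC_add_right scaleC_scaleC by (simp add: mult.commute)
    show "bounded_linear U"
    \<comment> \<open>The constant comes from \<parallel>U x\<parallel> \<le>
      \<parallel>x\<parallel> + \<parallel>U x\<parallel> / 2.\<close>
    proof (rule bounded_linear_intro[where K = 2])
      show "norm (U x) \<le> norm x * 2" for x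
        using norm_triangle_ineq[of x "c *\<^sub>C R (U x)"] cR[of "U x"] unfolding fU by simp
    qed (simp_all add: add scaleR_eq_scaleC scale)
  qed
  moreover have "U y = u \<longleftrightarrow> u - c *\<^sub>C R u = y" for y u
    unfolding U f_def by (metis add_diff_cancel_right' diff_add_cancel)
  ultimately show ?thesis by (rule that)
qed

text \<open>On the domain, \<open>T - z' = (1 - c R) (T - z)\<close> with \<open>c = z' - z\<close>,
  so if \<open>U\<close> inverts \<open>1 - c R\<close>, then \<open>R\<close> after
  \<open>U\<close> inverts \<open>T - z'\<close>. The consequence wanted is that the real spectrum
  is closed, hence a Borel set of the line.\<close>

lemma open_resolvent_set: "open (resolvent_set T)"
  unfolding open_dist
proof
  fix z assume "z \<in> resolvent_set T"
  then obtain R where R: "bounded_clinear R"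
      "\<And>x. x \<in> dom T \<Longrightarrow> R (the (T x) - z *\<^sub>C x) = x"
      "\<And>y. R y \<in> dom T" "\<And>y. the (T (R y)) - z *\<^sub>C R y = y"
    unfolding resolvent_set_def by blast
  obtain K where K: "K > 0" "\<And>x. norm (R x) \<le> norm x * K"
    using bounded_linear.pos_bounded[OF bounded_clinearD(3)[OF R(1)]] by blast
  have "z' \<in> resolvent_set T" if z': "dist z' z < 1 / (2 * K)" for z'
  proof -
    define c where "c = z' - z"
    have c: "cmod c * K \<le> 1 / 2"
      using z' K(1) by (simp add: c_def dist_norm field_simps)
    obtain U where U: "bounded_clinear U" "\<And>y u. U y = u \<longleftrightarrow> u - c *\<^sub>C R u = y"
      by (rule bounded_clinear_resolvent_perturbation[OF R(1) K(2) c]) blast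
    have shift: "the (T x) - z' *\<^sub>C x = (the (T x) - z *\<^sub>C x) - c *\<^sub>C x" for x
    proof -
      have "z' *\<^sub>C x = z *\<^sub>C x + c *\<^sub>C x" by (simp add: c_def flip: scaleC_add_left)
      then show ?thesis by simp
    qed
    have "bounded_clinear (\<lambda>y. R (U y))"
      using R(1) U(1) unfolding bounded_clinear_def by (auto intro: bounded_linear_compose)
    moreover have "R (U (the (T x) - z' *\<^sub>C x)) = x" if x: "x \<in> dom T" for x
    proof -
      have "U (the (T x) - z' *\<^sub>C x) = the (T x) - z *\<^sub>C x"
        unfolding U(2) R(2)[OF x] shift ..
      then show ?thesis by (simp add: R(2)[OF x])
    qed
    moreover have "R (U y) \<in> dom T \<and> the (T (R (U y))) - z' *\<^sub>C R (U y) = y" for y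
      using R(3) U(2)[of y "U y"] unfolding shift R(4) by simp
    ultimately show ?thesis unfolding resolvent_set_def by blast
  qed
  then show "\<exists>e>0. \<forall>z'. dist z' z < e \<longrightarrow> z' \<in> resolvent_set T"
    using K(1) by (intro exI[of _ "1 / (2 * K)"]) simp
qed

lemma closed_real_spectrum: "closed {t::real. complex_of_real t \<in> spectrum T}"
proof -
  have "closed (complex_of_real -` spectrum T)"
    by (rule continuous_closed_vimage)
       (auto simp: spectrum_def open_resolvent_set closed_Compl intro!: continuous_intros)
  then show ?thesis by (simp add: vimage_def)
qed

lemma space_spectrum_borel: "space (spectrum_borel T) = {t. complex_of_real t \<in> spectrum T}"
  by (simp add: spectrum_borel_def space_restrict_space)

lemma sets_spectrum_borel_iff:
  "A \<in> sets (spectrum_borel T) \<longleftrightarrow> A \<in> sets borel \<and> A \<subseteq> {t. complex_of_real t \<in> spectrum T}"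
  unfolding spectrum_borel_def
  by (subst sets_restrict_space_iff) (auto simp: borel_closed[OF closed_real_spectrum])

subsection \<open>Measures on sequences of bits\<close>

abbreviation bit_space :: "(nat \<Rightarrow> bool) measure" where
  "bit_space \<equiv> \<Pi>\<^sub>M n\<in>UNIV. count_space UNIV"

text \<open>Split \<open>[0, 1)\<close> into nested half-open intervals of length \<open>m l\<close>, one for every finite bit
  string \<open>l\<close>; a uniformly distributed point then produces the required random bits.\<close>

lemma bit_measure_exists:
  fixes m :: "bool list \<Rightarrow> real"
  assumes m_nonneg: "\<And>l. 0 \<le> m l" and m_Nil: "m [] = 1"
    and m_split: "\<And>l. m l = m (l @ [False]) + m (l @ [True])"
  obtains \<nu> where "prob_space \<nu>" "sets \<nu> = sets bit_space"
    "\<And>l. measure \<nu> {x. \<forall>n<length l. x n = l ! n} = m l"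
proof -
  \<comment> \<open>The left end of the interval of \<open>l\<close>: each True bit, at position
    \<open>n\<close>, skips the interval of the string that agrees with \<open>l\<close> before
    \<open>n\<close> and has False there.\<close>
  define left where "left l = (\<Sum>n<length l. if l ! n then m (take n l @ [False]) else 0)" for l
  have left_Nil: "left [] = 0" by (simp add: left_def)
  have left_snoc: "left (l @ [b]) = left l + (if b then m (l @ [False]) else 0)" for l b
    by (auto simp: left_def nth_append intro!: sum.cong)
  \<comment> \<open>\<open>pre u n\<close> is the string of length \<open>n\<close> whose interval
    contains \<open>u\<close>; the next bit is True when \<open>u\<close> lies at or beyond the
    right end of the False part.\<close>
  define pre where "pre u = rec_nat [] (\<lambda>n l. l @ [left l + m (l @ [False]) \<le> u])" for u :: real
  have pre_0: "pre u 0 = []"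
    and pre_Suc: "pre u (Suc n) = pre u n @ [left (pre u n) + m (pre u n @ [False]) \<le> u]" for u n
    by (simp_all add: pre_def)
  have length_pre: "length (pre u n) = n" for u n
    by (induction n) (auto simp: pre_0 pre_Suc)
  define X where "X u n = pre u (Suc n) ! n" for u n
  have pre_X: "pre u n = map (X u) [0..<n]" for u n
  proof (induction n)
    case (Suc n)
    have "X u n = (left (pre u n) + m (pre u n @ [False]) \<le> u)"
      by (simp add: X_def pre_Suc nth_append length_pre)
    with Suc show ?case by (simp add: pre_Suc)
  qed (simp add: pre_0)
  \<comment> \<open>Half-open intervals make this exact also for strings of mass 0, whose intervals
    are empty.\<close>
  have pre_iff: "pre u (length l) = l \<longleftrightarrow> left l \<le> u \<and> u < left l + m l" if u: "0 \<le> u" "u < 1" for u l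
  proof (induction l rule: rev_induct)
    case Nil
    show ?case using u by (simp add: pre_0 left_Nil m_Nil)
  next
    case (snoc b l)
    have "pre u (length (l @ [b])) = l @ [b] \<longleftrightarrow>
        pre u (length l) = l \<and> (left l + m (l @ [False]) \<le> u) = b"
      by (auto simp: pre_Suc)
    also have "\<dots> \<longleftrightarrow> left (l @ [b]) \<le> u \<and> u < left (l @ [b]) + m (l @ [b])"
      unfolding snoc left_snoc
      using m_nonneg[of "l @ [True]"] m_nonneg[of "l @ [False]"] m_split[of l] by (cases b) auto
    finally show ?case .
  qed
  define U where "U = restrict_space lborel {0..<1::real}"
  have space_U: "space U = {0..<1}" by (simp add: U_def space_restrict_space)
  have U: "prob_space U"
    by (rule prob_spaceI) (simp add: U_def emeasure_restrict_space space_restrict_space)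
  have sub: "{left l..<left l + m l} \<subseteq> {0..<1}" for l
  proof -
    have "0 \<le> left l" unfolding left_def by (intro sum_nonneg) (auto simp: m_nonneg)
    moreover have "left l + m l \<le> 1"
    proof (induction l rule: rev_induct)
      case (snoc b l)
      then show ?case
        using m_nonneg[of "l @ [True]"] m_nonneg[of "l @ [False]"] m_split[of l]
        by (cases b) (auto simp: left_snoc)
    qed (simp add: left_Nil m_Nil)
    ultimately show ?thesis by auto
  qed
  have cell: "{u \<in> space U. pre u (length l) = l} = {left l..<left l + m l}" for l
  proof (rule set_eqI)
    fix u
    show "u \<in> {u \<in> space U. pre u (length l) = l} \<longleftrightarrow> u \<in> {left l..<left l + m l}"
      using pre_iff[of u l] subsetD[OF sub[of l], of u] by (auto simp: space_U)
  qed
  have cell_sets: "{u \<in> space U. pre u (length l) = l} \<in> sets U" for l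
    unfolding cell unfolding U_def sets_restrict_space
  proof (rule image_eqI)
    show "{left l..<left l + m l} = {0..<1} \<inter> {left l..<left l + m l}" using sub[of l] by blast
  qed simp
  have [measurable]: "(\<lambda>u. pre u n) \<in> U \<rightarrow>\<^sub>M count_space UNIV" for n
  proof (subst measurable_count_space_eq2_countable, intro conjI ballI)
    fix l :: "bool list"
    show "(\<lambda>u. pre u n) -` {l} \<inter> space U \<in> sets U"
    proof (cases "length l = n")
      case True
      then have "(\<lambda>u. pre u n) -` {l} \<inter> space U = {u \<in> space U. pre u (length l) = l}" by auto
      then show ?thesis using cell_sets[of l] by simp
    next
      case False
      then have "(\<lambda>u. pre u n) -` {l} \<inter> space U = {}" using length_pre by auto
      then show ?thesis by simp
    qed
  qed auto
  have X: "X \<in> U \<rightarrow>\<^sub>M bit_space"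
    by (rule measurable_PiM_single') (simp_all add: X_def)
  have "measure (distr U bit_space X) {x. \<forall>n<length l. x n = l ! n} = m l" for l
  proof -
    have "{x. \<forall>n<length l. x n = l ! n} = {x \<in> space bit_space. \<forall>n<length l. x n = l ! n}"
      by (simp add: space_PiM)
    also have "\<dots> \<in> sets bit_space" by measurable
    finally have sets: "{x. \<forall>n<length l. x n = l ! n} \<in> sets bit_space" .
    have "measure (distr U bit_space X) {x. \<forall>n<length l. x n = l ! n}
        = measure U (X -` {x. \<forall>n<length l. x n = l ! n} \<inter> space U)"
      by (rule measure_distr[OF X sets])
    also have "X -` {x. \<forall>n<length l. x n = l ! n} \<inter> space U = {u \<in> space U. pre u (length l) = l}"
    proof -
      have "pre u (length l) = l \<longleftrightarrow> (\<forall>n<length l. X u n = l ! n)" for u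
        unfolding pre_X by (subst list_eq_iff_nth_eq) simp
      then show ?thesis by auto
    qed
    also have "measure U \<dots> = m l"
      unfolding cell unfolding U_def using sub[of l] by (simp add: measure_restrict_space m_nonneg)
    finally show ?thesis .
  qed
  moreover have "prob_space (distr U bit_space X)"
    by (rule prob_space.prob_space_distr[OF U X])
  ultimately show ?thesis by (intro that[of "distr U bit_space X"]) auto
qed

subsection \<open>Multimeasures\<close>

text \<open>\<open>F A\<close> is the weight of the rectangle with sides \<open>A i\<close>, \<open>i \<in> I\<close>; the other sides are junk.\<close>

definition prob_multimeasure ::
    "'i set \<Rightarrow> ('i \<Rightarrow> 'b measure) \<Rightarrow> (('i \<Rightarrow> 'b set) \<Rightarrow> real) \<Rightarrow> bool" where
  "prob_multimeasure I N F \<longleftrightarrow>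
     (\<forall>A. (\<forall>i\<in>I. A i \<in> sets (N i)) \<longrightarrow> 0 \<le> F A) \<and>
     (\<forall>A B. (\<forall>i\<in>I. A i = B i) \<longrightarrow> F A = F B) \<and>
     F (\<lambda>i. space (N i)) = 1 \<and>
     (\<forall>A i. \<forall>G :: nat \<Rightarrow> 'b set. (\<forall>j\<in>I. A j \<in> sets (N j)) \<longrightarrow> i \<in> I \<longrightarrow> range G \<subseteq> sets (N i) \<longrightarrow>
        disjoint_family G \<longrightarrow> (\<lambda>n. F (A(i := G n))) sums F (A(i := \<Union>n. G n)))"

lemma prob_multimeasureD:
  assumes "prob_multimeasure I N F"
  shows "(\<And>i. i \<in> I \<Longrightarrow> A i \<in> sets (N i)) \<Longrightarrow> 0 \<le> F A"
    and "(\<And>i. i \<in> I \<Longrightarrow> A i = B i) \<Longrightarrow> F A = F B"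
    and "F (\<lambda>i. space (N i)) = 1"
    and "(\<And>j. j \<in> I \<Longrightarrow> A j \<in> sets (N j)) \<Longrightarrow> i \<in> I \<Longrightarrow> range G \<subseteq> sets (N i) \<Longrightarrow>
        disjoint_family G \<Longrightarrow> (\<lambda>n::nat. F (A(i := G n))) sums F (A(i := \<Union>n. G n))"
proof -
  note conjs = assms[unfolded prob_multimeasure_def]
  show "(\<And>i. i \<in> I \<Longrightarrow> A i \<in> sets (N i)) \<Longrightarrow> 0 \<le> F A"
    using conjs[THEN conjunct1] by blast
  show "(\<And>i. i \<in> I \<Longrightarrow> A i = B i) \<Longrightarrow> F A = F B"
    using conjs[THEN conjunct2, THEN conjunct1] by blast
  show "F (\<lambda>i. space (N i)) = 1"
    by (rule conjs[THEN conjunct2, THEN conjunct2, THEN conjunct1])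
  show "(\<And>j. j \<in> I \<Longrightarrow> A j \<in> sets (N j)) \<Longrightarrow> i \<in> I \<Longrightarrow> range G \<subseteq> sets (N i) \<Longrightarrow>
        disjoint_family G \<Longrightarrow> (\<lambda>n::nat. F (A(i := G n))) sums F (A(i := \<Union>n. G n))"
    using conjs[THEN conjunct2, THEN conjunct2, THEN conjunct2] by blast
qed

text \<open>The constant sequence of empty sets is disjoint, and a constant series converges only if
  its terms are 0.\<close>

lemma multimeasure_empty:
  assumes F: "prob_multimeasure I N F" and A: "\<And>j. j \<in> I \<Longrightarrow> A j \<in> sets (N j)" and i: "i \<in> I"
  shows "F (A(i := {})) = 0"
proof -
  have "(\<lambda>n::nat. F (A(i := {}))) sums F (A(i := \<Union>n::nat. {}))"
    by (rule prob_multimeasureD(4)[OF F A i]) (auto simp: disjoint_family_on_def)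
  then show ?thesis using sums_summable summable_const_iff by blast
qed

lemma multimeasure_Un:
  assumes F: "prob_multimeasure I N F" and A: "\<And>j. j \<in> I \<Longrightarrow> A j \<in> sets (N j)" and i: "i \<in> I"
    and XY: "X \<in> sets (N i)" "Y \<in> sets (N i)" "X \<inter> Y = {}"
  shows "F (A(i := X \<union> Y)) = F (A(i := X)) + F (A(i := Y))"
proof (rule sums_unique2)
  have "range (binaryset X Y) \<subseteq> sets (N i)" using XY by (auto simp: binaryset_def)
  moreover have "disjoint_family (binaryset X Y)"
    using XY(3) by (auto simp: binaryset_def disjoint_family_on_def)
  ultimately show "(\<lambda>n. F (A(i := binaryset X Y n))) sums F (A(i := X \<union> Y))"
    using prob_multimeasureD(4)[OF F, of A i "binaryset X Y"] A i by (simp add: UN_binaryset_eq)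
  show "(\<lambda>n. F (A(i := binaryset X Y n))) sums (F (A(i := X)) + F (A(i := Y)))"
    by (rule binaryset_sums) (rule multimeasure_empty[OF F A i])
qed

text \<open>Puts a constructed measure into the same format as a given \<open>F\<close>, so that
  \<open>prob_multimeasure_unique\<close> can compare the two.\<close>

lemma prob_multimeasure_measure:
  assumes \<mu>: "prob_space \<mu>" and f: "\<And>i. i \<in> I \<Longrightarrow> f i \<in> \<mu> \<rightarrow>\<^sub>M N i" and I: "finite I"
  shows "prob_multimeasure I N (\<lambda>C. measure \<mu> {x \<in> space \<mu>. \<forall>i\<in>I. f i x \<in> C i})"
  unfolding prob_multimeasure_def
proof (intro conjI allI impI)
  interpret prob_space \<mu> by fact
  show "measure \<mu> {x \<in> space \<mu>. \<forall>i\<in>I. f i x \<in> space (N i)} = 1"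
  proof -
    have "{x \<in> space \<mu>. \<forall>i\<in>I. f i x \<in> space (N i)} = space \<mu>"
      using measurable_space[OF f] by auto
    then show ?thesis by (simp add: prob_space)
  qed
  fix A B :: "'b \<Rightarrow> 'c set"
  show "measure \<mu> {x \<in> space \<mu>. \<forall>i\<in>I. f i x \<in> A i} = measure \<mu> {x \<in> space \<mu>. \<forall>i\<in>I. f i x \<in> B i}"
    if "\<forall>i\<in>I. A i = B i"
    using that by simp
  fix i and G :: "nat \<Rightarrow> 'c set"
  assume A: "\<forall>j\<in>I. A j \<in> sets (N j)" and i: "i \<in> I" and G: "range G \<subseteq> sets (N i)" "disjoint_family G"
  define R where "R n = {x \<in> space \<mu>. \<forall>j\<in>I. f j x \<in> (A(i := G n)) j}" for n
  have "R n \<in> sets \<mu>" for n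
    unfolding R_def
  proof (rule sets.sets_Collect_finite_All[OF _ I])
    fix j assume "j \<in> I"
    then have "f j -` (A(i := G n)) j \<inter> space \<mu> \<in> sets \<mu>"
      using A G(1) by (intro measurable_sets[OF f]) auto
    then show "{x \<in> space \<mu>. f j x \<in> (A(i := G n)) j} \<in> sets \<mu>"
      by (simp only: vimage_def Int_def mem_Collect_eq conj_commute)
  qed
  then have "range R \<subseteq> sets \<mu>" by blast
  moreover have "disjoint_family R"
  proof -
    have "f i x \<in> G n" if "x \<in> R n" for x n
      using that i by (force simp: R_def)
    then show ?thesis using G(2) unfolding disjoint_family_on_def by blast
  qed
  ultimately have "(\<lambda>n. measure \<mu> (R n)) sums measure \<mu> (\<Union>n. R n)"
    by (rule finite_measure_UNION)
  also have "(\<Union>n. R n) = {x \<in> space \<mu>. \<forall>j\<in>I. f j x \<in> (A(i := \<Union>n. G n)) j}"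
    using i by (auto simp: R_def)
  finally show "(\<lambda>n. measure \<mu> {x \<in> space \<mu>. \<forall>j\<in>I. f j x \<in> (A(i := G n)) j}) sums
      measure \<mu> {x \<in> space \<mu>. \<forall>j\<in>I. f j x \<in> (A(i := \<Union>n. G n)) j}"
    unfolding R_def .
qed simp

lemma prob_multimeasure_vimage:
  assumes F: "prob_multimeasure I N F" and e: "\<And>i. i \<in> I \<Longrightarrow> e i \<in> N i \<rightarrow>\<^sub>M N' i"
  shows "prob_multimeasure I N' (\<lambda>C. F (\<lambda>i. e i -` C i \<inter> space (N i)))"
  unfolding prob_multimeasure_def
proof (intro conjI allI impI)
  note D = prob_multimeasureD[OF F]
  have upd: "(\<lambda>j. e j -` (A(i := X)) j \<inter> space (N j)) =
      (\<lambda>j. e j -` A j \<inter> space (N j))(i := e i -` X \<inter> space (N i))" for A i X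
    by (simp add: fun_eq_iff)
  have "F (\<lambda>i. e i -` space (N' i) \<inter> space (N i)) = F (\<lambda>i. space (N i))"
    by (rule D(2)) (use measurable_space[OF e] in auto)
  with D(3) show "F (\<lambda>i. e i -` space (N' i) \<inter> space (N i)) = 1" by simp
  fix A B :: "'a \<Rightarrow> 'c set"
  show "0 \<le> F (\<lambda>i. e i -` A i \<inter> space (N i))" if "\<forall>i\<in>I. A i \<in> sets (N' i)"
    using that e by (intro D(1)) auto
  show "F (\<lambda>i. e i -` A i \<inter> space (N i)) = F (\<lambda>i. e i -` B i \<inter> space (N i))" if "\<forall>i\<in>I. A i = B i"
    using that by (intro D(2)) auto
  fix i and G :: "nat \<Rightarrow> 'c set"
  assume A: "\<forall>j\<in>I. A j \<in> sets (N' j)" and i: "i \<in> I" and G: "range G \<subseteq> sets (N' i)" "disjoint_family G"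
  have "(\<lambda>n. F ((\<lambda>j. e j -` A j \<inter> space (N j))(i := e i -` G n \<inter> space (N i)))) sums
      F ((\<lambda>j. e j -` A j \<inter> space (N j))(i := \<Union>n. e i -` G n \<inter> space (N i)))"
  proof (rule D(4))
    show "e j -` A j \<inter> space (N j) \<in> sets (N j)" if "j \<in> I" for j
      using A e that by auto
    show "range (\<lambda>n. e i -` G n \<inter> space (N i)) \<subseteq> sets (N i)"
      using G(1) e[OF i] by (auto intro: measurable_sets)
    show "disjoint_family (\<lambda>n. e i -` G n \<inter> space (N i))"
      using G(2) unfolding disjoint_family_on_def by blast
  qed (use i in auto)
  moreover have "(\<Union>n. e i -` G n \<inter> space (N i)) = e i -` (\<Union>n. G n) \<inter> space (N i)" by auto
  ultimately show "(\<lambda>n. F (\<lambda>j. e j -` (A(i := G n)) j \<inter> space (N j))) sums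
      F (\<lambda>j. e j -` (A(i := \<Union>n. G n)) j \<inter> space (N j))"
    unfolding upd by simp
qed

text \<open>The sides are released one at a time. By induction on \<open>J\<close> the two functions
  agree when the sides in \<open>J\<close> are arbitrary measurable sets and the others lie in the
  generators; a Dynkin argument in the single side \<open>j\<close> adds \<open>j\<close> to
  \<open>J\<close>.\<close>

lemma prob_multimeasure_unique:
  assumes F: "prob_multimeasure I N F" and F': "prob_multimeasure I N F'" and I: "finite I"
    and gen: "\<And>i. i \<in> I \<Longrightarrow> sets (N i) = sigma_sets (space (N i)) (\<G> i)"
    and stable: "\<And>i. i \<in> I \<Longrightarrow> Int_stable (\<G> i)" and space: "\<And>i. i \<in> I \<Longrightarrow> space (N i) \<in> \<G> i"
    and eq: "\<And>A. (\<And>i. i \<in> I \<Longrightarrow> A i \<in> \<G> i) \<Longrightarrow> F A = F' A"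
    and A: "\<And>i. i \<in> I \<Longrightarrow> A i \<in> sets (N i)"
  shows "F A = F' A"
proof -
  have \<G>: "\<G> i \<subseteq> sets (N i)" if "i \<in> I" for i
    using gen[OF that] by auto
  have "\<forall>A. (\<forall>i\<in>J. A i \<in> sets (N i)) \<longrightarrow> (\<forall>i\<in>I - J. A i \<in> \<G> i) \<longrightarrow> F A = F' A" if "finite J" "J \<subseteq> I" for J
    using that
  proof (induction J rule: finite_induct)
    case empty
    then show ?case using eq by simp
  next
    case (insert j J)
    then have j: "j \<in> I" and J: "J \<subseteq> I" by auto
    show ?case
    proof (intro allI impI)
      fix A assume A1: "\<forall>i\<in>insert j J. A i \<in> sets (N i)" and A2: "\<forall>i\<in>I - insert j J. A i \<in> \<G> i"
      have meas: "A i \<in> sets (N i)" if "i \<in> I" for i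
        using A1 A2 \<G> that by blast
      have IH: "F (A(j := D)) = F' (A(j := D))" if "D \<in> \<G> j" for D
        using insert.IH[OF J] A1 A2 that insert.hyps(2) by (auto simp: fun_upd_def)
      have closed: "\<G> j \<subseteq> Pow (space (N j))"
        using \<G>[OF j] sets.space_closed by blast
      define same where "same D \<longleftrightarrow> F (A(j := D)) = F' (A(j := D))" for D
      have "same D" if "D \<in> sigma_sets (space (N j)) (\<G> j)" for D
        using stable[OF j] closed that
      proof (induction D rule: sigma_sets_induct_disjoint)
        case (basic D)
        then show ?case unfolding same_def by (rule IH)
      next
        case empty
        have "F (A(j := {})) = F' (A(j := {}))"
          using multimeasure_empty[OF F meas j] multimeasure_empty[OF F' meas j] by simp
        then show ?case by (simp only: same_def)
      next
        case (compl D)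
        then have D: "D \<in> sets (N j)" using gen[OF j] by simp
        \<comment> \<open>The whole space lies in the generator, so the induction hypothesis covers
          it, and additivity yields the complement by subtraction.\<close>
        have split: "D \<union> (space (N j) - D) = space (N j)"
          using sets.sets_into_space[OF D] by blast
        have "F (A(j := space (N j) - D)) = F' (A(j := space (N j) - D))"
          using multimeasure_Un[OF F meas j D, of "space (N j) - D"]
            multimeasure_Un[OF F' meas j D, of "space (N j) - D"] D IH[OF space[OF j]] compl(2)[unfolded same_def]
          unfolding split by auto
        then show ?case by (simp only: same_def)
      next
        case (union D)
        then have "range D \<subseteq> sets (N j)" using gen[OF j] by simp
        then have "(\<lambda>n. F (A(j := D n))) sums F (A(j := \<Union>n. D n))"
          and "(\<lambda>n. F' (A(j := D n))) sums F' (A(j := \<Union>n. D n))"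
          using prob_multimeasureD(4)[OF F meas j] prob_multimeasureD(4)[OF F' meas j] union(1) by blast+
        then have "F (A(j := \<Union>n. D n)) = F' (A(j := \<Union>n. D n))"
          unfolding union(3)[unfolded same_def] by (rule sums_unique2)
        then show ?case by (simp only: same_def)
      qed
      from this[of "A j"] show "F A = F' A"
        using meas[OF j] gen[OF j] by (simp add: same_def)
    qed
  qed
  from this[OF I subset_refl] show ?thesis using A by simp
qed

text \<open>Descending induction on the number \<open>k\<close> of leading sides that are
  singletons. At \<open>k = L\<close> the cylinder comes from a string; the step down splits side
  \<open>k\<close> into its False and True parts.\<close>

lemma additive_cylinder_unique:
  fixes f g :: "(nat \<Rightarrow> bool set) \<Rightarrow> real"
  assumes f: "\<And>s n X Y. X \<inter> Y = {} \<Longrightarrow> f (s(n := X \<union> Y)) = f (s(n := X)) + f (s(n := Y))"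
    and g: "\<And>s n X Y. X \<inter> Y = {} \<Longrightarrow> g (s(n := X \<union> Y)) = g (s(n := X)) + g (s(n := Y))"
    and eq: "\<And>l. f (\<lambda>n. if n < length l then {l ! n} else UNIV) = g (\<lambda>n. if n < length l then {l ! n} else UNIV)"
    and s: "\<And>n. L \<le> n \<Longrightarrow> s n = UNIV"
  shows "f s = g s"
proof -
  have "\<forall>s. (\<forall>n\<ge>L. s n = UNIV) \<longrightarrow> (\<forall>n<k. \<exists>b. s n = {b}) \<longrightarrow> f s = g s" if "k \<le> L" for k
    using that
  proof (induction k rule: inc_induct)
    case base
    show ?case
    proof (intro allI impI)
      fix s :: "nat \<Rightarrow> bool set"
      assume 1: "\<forall>n\<ge>L. s n = UNIV" and "\<forall>n<L. \<exists>b. s n = {b}"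
      then obtain b where "\<forall>n<L. s n = {b n}" by metis
      with 1 have "s = (\<lambda>n. if n < length (map b [0..<L]) then {map b [0..<L] ! n} else UNIV)"
        by (auto simp: fun_eq_iff)
      with eq[of "map b [0..<L]"] show "f s = g s" by simp
    qed
  next
    case (step k)
    show ?case
    proof (intro allI impI)
      fix s :: "nat \<Rightarrow> bool set"
      assume 1: "\<forall>n\<ge>L. s n = UNIV" "\<forall>n<k. \<exists>b. s n = {b}"
      have single: "f (s(k := {b})) = g (s(k := {b}))" for b
      proof -
        have "\<forall>n<Suc k. \<exists>c. (s(k := {b})) n = {c}" using 1(2) by (auto simp: less_Suc_eq)
        moreover have "\<forall>n\<ge>L. (s(k := {b})) n = UNIV" using 1(1) step.hyps(2) by auto
        ultimately show ?thesis using step.IH by blast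
      qed
      \<comment> \<open>A side may lack one of the bits; additivity for two empty sets gives the
        value of the missing part.\<close>
      have empty: "f (s(k := {})) = 0" "g (s(k := {})) = 0"
        using f[of "{}" "{}" s k] g[of "{}" "{}" s k] by simp_all
      have "f (s(k := s k \<inter> {b})) = g (s(k := s k \<inter> {b}))" for b
        using single[of b] empty by (cases "b \<in> s k") simp_all
      moreover have "s k = (s k \<inter> {False}) \<union> (s k \<inter> {True})" by auto
      moreover have "(s k \<inter> {False}) \<inter> (s k \<inter> {True}) = {}" by auto
      ultimately have "f (s(k := s k)) = g (s(k := s k))"
        using f[of "s k \<inter> {False}" "s k \<inter> {True}" s k] g[of "s k \<inter> {False}" "s k \<inter> {True}" s k]
        by metis
      then show "f s = g s" by simp
    qed
  qed
  from this[of 0] s show ?thesis by simp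
qed

text \<open>The bits of all coordinates are interleaved into one sequence along a bijection between
  the naturals and \<open>I \<times> UNIV\<close>. The values of \<open>F\<close> on prefixes feed
  \<open>bit_measure_exists\<close>; agreement spreads to cylinders by finite additivity and to all
  measurable sides by \<open>prob_multimeasure_unique\<close>.\<close>

lemma joint_bit_measure:
  fixes F :: "('i \<Rightarrow> (nat \<Rightarrow> bool) set) \<Rightarrow> real"
  assumes F: "prob_multimeasure I (\<lambda>_. bit_space) F" and I: "finite I" "I \<noteq> {}"
  obtains \<nu> and enc :: "'i \<times> nat \<Rightarrow> nat" where "prob_space \<nu>" "sets \<nu> = sets bit_space"
    "\<And>C. (\<And>i. i \<in> I \<Longrightarrow> C i \<in> sets bit_space) \<Longrightarrow>
      measure \<nu> {x. \<forall>i\<in>I. (\<lambda>k. x (enc (i, k))) \<in> C i} = F C"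
proof -
  have "countable (I \<times> (UNIV :: nat set))" "infinite (I \<times> (UNIV :: nat set))"
    using I by (auto simp: countable_finite finite_cartesian_product_iff)
  then have "bij_betw (from_nat_into (I \<times> (UNIV :: nat set))) UNIV (I \<times> UNIV)"
    by (rule bij_betw_from_nat_into)
  then obtain idx :: "nat \<Rightarrow> 'i \<times> nat" where idx: "bij_betw idx UNIV (I \<times> UNIV)" ..
  define enc where "enc = inv idx"
  have enc_idx: "enc (idx n) = n" for n
    using bij_betw_imp_inj_on[OF idx] by (simp add: enc_def)
  have idx_enc: "idx (enc (i, k)) = (i, k)" if "i \<in> I" for i k
    using idx that by (auto simp: enc_def bij_betw_def intro!: f_inv_into_f)
  have fst_idx: "fst (idx n) \<in> I" for n
    using bij_betwE[OF idx] by (metis UNIV_I mem_Times_iff)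
  \<comment> \<open>Conditions \<open>s n\<close> on the single bits of the interleaved sequence,
    read as a rectangle: side \<open>i\<close> collects those on the bits of coordinate
    \<open>i\<close>.\<close>
  define cyl where "cyl s i = {y. \<forall>k. y k \<in> s (enc (i, k))}" for s :: "nat \<Rightarrow> bool set" and i
  have cyl_sets: "cyl s i \<in> sets bit_space" for s i
  proof -
    have "cyl s i = {y \<in> space bit_space. \<forall>k. y k \<in> s (enc (i, k))}"
      by (simp add: cyl_def space_PiM)
    also have "\<dots> \<in> sets bit_space" by measurable
    finally show ?thesis .
  qed
  \<comment> \<open>Bit \<open>n\<close> belongs to exactly one coordinate, so changing
    \<open>s n\<close> affects only one side with index in \<open>I\<close>, and additivity in that
    side applies.\<close>
  have additive: "G (cyl (s(n := X \<union> Y))) = G (cyl (s(n := X))) + G (cyl (s(n := Y)))"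
    if G: "prob_multimeasure I (\<lambda>_. bit_space) G" and XY: "X \<inter> Y = {}" for G s n X Y
  proof -
    obtain i k where ik: "idx n = (i, k)" by fastforce
    have i: "i \<in> I" using fst_idx[of n] ik by simp
    define D where "D X = cyl (s(n := X)) i" for X
    have D: "D X = {y. y k \<in> X \<and> (\<forall>k'. k' \<noteq> k \<longrightarrow> y k' \<in> s (enc (i, k')))}" for X
    proof -
      have "enc (i, k') = n \<longleftrightarrow> k' = k" for k'
        using idx_enc[OF i, of k'] enc_idx[of n] ik by (metis prod.inject)
      then show ?thesis
        unfolding D_def cyl_def fun_upd_apply by (intro Collect_cong) (auto split: if_splits)
    qed
    have G_upd: "G (cyl (s(n := X))) = G ((cyl s)(i := D X))" for X
    proof (rule prob_multimeasureD(2)[OF G])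
      fix j assume j: "j \<in> I"
      show "cyl (s(n := X)) j = ((cyl s)(i := D X)) j"
      proof (cases "j = i")
        case False
        then have "enc (j, k') \<noteq> n" for k'
          using idx_enc[OF j, of k'] ik by auto
        then show ?thesis using False by (simp add: cyl_def)
      qed (simp add: D_def)
    qed
    have "D (X \<union> Y) = D X \<union> D Y" "D X \<inter> D Y = {}"
      unfolding D using XY by auto
    moreover have "D X \<in> sets bit_space" for X
      unfolding D_def by (rule cyl_sets)
    ultimately show ?thesis
      unfolding G_upd using multimeasure_Un[OF G _ i, of "cyl s" "D X" "D Y"] cyl_sets by simp
  qed
  define prefix where "prefix l n = (if n < length l then {l ! n} else UNIV)" for l :: "bool list" and n
  define m where "m l = F (cyl (prefix l))" for l
  have m_nonneg: "0 \<le> m l" for l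
    unfolding m_def by (rule prob_multimeasureD(1)[OF F]) (rule cyl_sets)
  have "cyl (prefix []) = (\<lambda>i. space bit_space)"
    by (simp add: fun_eq_iff cyl_def prefix_def space_PiM)
  then have m_Nil: "m [] = 1"
    unfolding m_def using prob_multimeasureD(3)[OF F] by simp
  have m_split: "m l = m (l @ [False]) + m (l @ [True])" for l
  proof -
    have "prefix (l @ [b]) = (prefix l)(length l := {b})" for b
      by (auto simp: prefix_def fun_eq_iff nth_append)
    moreover have "prefix l = (prefix l)(length l := {False} \<union> {True})"
      by (auto simp: prefix_def fun_eq_iff)
    ultimately show ?thesis
      unfolding m_def using additive[OF F, of "{False}" "{True}" "prefix l" "length l"] by simp
  qed
  obtain \<nu> where \<nu>: "prob_space \<nu>" "sets \<nu> = sets bit_space"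
    "\<And>l. measure \<nu> {x. \<forall>n<length l. x n = l ! n} = m l"
    using bit_measure_exists[of m, OF m_nonneg m_Nil m_split] by blast
  have space_\<nu>: "space \<nu> = UNIV"
    using sets_eq_imp_space_eq[OF \<nu>(2)] by (simp add: space_PiM)
  define H where "H C = measure \<nu> {x \<in> space \<nu>. \<forall>i\<in>I. (\<lambda>k. x (enc (i, k))) \<in> C i}" for C
  have H: "prob_multimeasure I (\<lambda>_. bit_space) H"
    unfolding H_def
  proof (rule prob_multimeasure_measure[OF \<nu>(1) _ I(1)])
    fix i assume "i \<in> I"
    have "(\<lambda>x k. x (enc (i, k))) \<in> bit_space \<rightarrow>\<^sub>M bit_space"
      by (rule measurable_PiM_single') simp_all
    then show "(\<lambda>x k. x (enc (i, k))) \<in> \<nu> \<rightarrow>\<^sub>M bit_space"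
      using measurable_cong_sets[OF \<nu>(2) refl] by blast
  qed
  have H_cyl: "H (cyl s) = measure \<nu> {x. \<forall>n. x n \<in> s n}" for s
  proof -
    have "(\<forall>i\<in>I. (\<lambda>k. x (enc (i, k))) \<in> cyl s i) \<longleftrightarrow> (\<forall>n. x n \<in> s n)" for x
    proof
      assume *: "\<forall>i\<in>I. (\<lambda>k. x (enc (i, k))) \<in> cyl s i"
      show "\<forall>n. x n \<in> s n"
      proof
        fix n
        obtain i k where "idx n = (i, k)" by fastforce
        then have "i \<in> I" "enc (i, k) = n" using fst_idx[of n] enc_idx[of n] by auto
        with * show "x n \<in> s n" unfolding cyl_def by blast
      qed
    qed (simp add: cyl_def)
    then show ?thesis by (simp add: H_def space_\<nu>)
  qed
  have H_eq_F: "H C = F C" if C: "\<And>i. i \<in> I \<Longrightarrow> C i \<in> sets bit_space" for C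
  proof (rule prob_multimeasure_unique[OF H F I(1)])
    let ?\<G> = "\<lambda>i. prod_algebra UNIV (\<lambda>_::nat. count_space (UNIV :: bool set))"
    show "sets bit_space = sigma_sets (space bit_space) (?\<G> i)" for i
      unfolding sets_PiM space_PiM ..
    show "Int_stable (?\<G> i)" for i by (rule Int_stable_prod_algebra)
    show "space bit_space \<in> ?\<G> i" for i
    proof -
      \<comment> \<open>The whole space is written with a vacuous condition on bit 0, because
        \<open>prod_algebra\<close> asks for a nonempty set of restricted indices here.\<close>
      have "prod_emb UNIV (\<lambda>_. count_space UNIV) {0} (PiE {0} (\<lambda>_. UNIV)) \<in> ?\<G> i"
        by (rule prod_algebraI) auto
      also have "prod_emb UNIV (\<lambda>_. count_space UNIV) {0::nat} (PiE {0} (\<lambda>_. UNIV :: bool set)) = space bit_space"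
        by (auto simp: prod_emb_def space_PiM)
      finally show ?thesis .
    qed
    fix A assume A: "\<And>i. i \<in> I \<Longrightarrow> A i \<in> ?\<G> i"
    have "\<exists>JE. finite (fst JE) \<and> A i = {y. \<forall>k\<in>fst JE. y k \<in> snd JE k}" if i: "i \<in> I" for i
      using A[OF i]
    proof (rule prod_algebraE)
      fix J E
      assume "A i = prod_emb UNIV (\<lambda>_. count_space UNIV) J (Pi\<^sub>E J E)" "finite J"
      then show ?thesis
        by (intro exI[of _ "(J, E)"]) (auto simp: prod_emb_def restrict_PiE_iff)
    qed
    then have "\<forall>i\<in>I. \<exists>JE. finite (fst JE) \<and> A i = {y. \<forall>k\<in>fst JE. y k \<in> snd JE k}"
      by simp
    from bchoice[OF this] obtain JE where
      JE': "\<forall>i\<in>I. finite (fst (JE i)) \<and> A i = {y. \<forall>k\<in>fst (JE i). y k \<in> snd (JE i) k}" by (rule exE)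
    define J E where "J i = fst (JE i)" and "E i = snd (JE i)" for i
    have JE: "finite (J i)" "A i = {y. \<forall>k\<in>J i. y k \<in> E i k}" if "i \<in> I" for i
      using JE' that by (simp_all add: J_def E_def)
    \<comment> \<open>Finitely many sides, each restricting finitely many bits, merge into one
      cylinder whose conditions are trivial from some \<open>L\<close> on.\<close>
    define s where "s n = (case idx n of (i, k) \<Rightarrow> if k \<in> J i then E i k else UNIV)" for n
    have cyl_s: "cyl s i = A i" if "i \<in> I" for i
      using JE(2)[OF that] by (auto simp: cyl_def s_def idx_enc[OF that])
    have "finite (enc ` (SIGMA i:I. J i))"
      using I(1) JE(1) by auto
    then obtain L where L: "\<And>n. n \<in> enc ` (SIGMA i:I. J i) \<Longrightarrow> n < L"
      unfolding finite_nat_set_iff_bounded by blast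
    have s: "s n = UNIV" if "L \<le> n" for n
    proof (cases "idx n")
      case (Pair i k)
      have "k \<notin> J i"
      proof
        assume "k \<in> J i"
        then have "idx n \<in> (SIGMA i:I. J i)" using fst_idx[of n] Pair by auto
        then have "n < L" using L enc_idx by (metis imageI)
        then show False using that by simp
      qed
      then show ?thesis by (simp add: s_def Pair)
    qed
    have "H (cyl s) = F (cyl s)"
    proof (rule additive_cylinder_unique[where f = "\<lambda>s. H (cyl s)" and g = "\<lambda>s. F (cyl s)"])
      show "H (cyl (\<lambda>n. if n < length l then {l ! n} else UNIV)) =
          F (cyl (\<lambda>n. if n < length l then {l ! n} else UNIV))" for l
      proof -
        have "{x. \<forall>n. x n \<in> prefix l n} = {x. \<forall>n<length l. x n = l ! n}"
          by (auto simp: prefix_def)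
        then have "H (cyl (prefix l)) = F (cyl (prefix l))"
          using \<nu>(3)[of l] by (simp add: H_cyl m_def)
        then show ?thesis by (simp add: prefix_def[abs_def])
      qed
    qed (use additive[OF H] additive[OF F] s in blast)+
    moreover have "H (cyl s) = H A" "F (cyl s) = F A"
      using prob_multimeasureD(2)[OF H] prob_multimeasureD(2)[OF F] cyl_s by blast+
    ultimately show "H A = F A" by simp
  qed (fact C)
  show ?thesis
    using \<nu>(1,2) H_eq_F by (intro that[of \<nu> enc]) (simp_all add: H_def space_\<nu>)
qed

text \<open>A point \<open>t\<close> is coded by the truth values of \<open>t \<le> q\<close> for rational \<open>q\<close>, and recovered as the
  infimum of those \<open>q\<close>.\<close>

lemma borel_coding:
  fixes S :: "real set"
  assumes S: "S \<in> sets borel" "S \<noteq> {}"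
  obtains e d where "e \<in> restrict_space borel S \<rightarrow>\<^sub>M bit_space" "d \<in> bit_space \<rightarrow>\<^sub>M restrict_space borel S"
    "\<And>t. t \<in> S \<Longrightarrow> d (e t) = t"
proof -
  define q where "q k = real_of_rat (from_nat k)" for k
  define e where "e t k \<longleftrightarrow> t \<le> q k" for t k
  obtain s where s: "s \<in> S" using S(2) by blast
  \<comment> \<open>In the extended reals the infimum exists for every bit sequence, including those
    that code no point.\<close>
  define r where "r y = real_of_ereal (INF k. if y k then ereal (q k) else \<infinity>)" for y :: "nat \<Rightarrow> bool"
  \<comment> \<open>Sequences decoded outside \<open>S\<close> go to the fixed point
    \<open>s\<close>, so that \<open>d\<close> maps into \<open>S\<close>.\<close>
  define d where "d y = (if r y \<in> S then r y else s)" for y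
  have r_e: "r (e t) = t" for t
  proof -
    have "(INF k. if e t k then ereal (q k) else \<infinity>) = ereal t"
    proof (rule antisym)
      show "ereal t \<le> (INF k. if e t k then ereal (q k) else \<infinity>)"
        by (rule INF_greatest) (simp add: e_def)
      show "(INF k. if e t k then ereal (q k) else \<infinity>) \<le> ereal t"
      proof (rule ereal_le_epsilon2)
        fix \<epsilon> :: real assume "0 < \<epsilon>"
        then obtain a where a: "t < real_of_rat a" "real_of_rat a < t + \<epsilon>"
          using of_rat_dense[of t "t + \<epsilon>"] by auto
        obtain k where k: "from_nat k = a" by (metis from_nat_to_nat)
        have "(INF k. if e t k then ereal (q k) else \<infinity>) \<le> (if e t k then ereal (q k) else \<infinity>)"
          by (rule INF_lower) simp
        also have "\<dots> \<le> ereal t + ereal \<epsilon>"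
          using a by (simp add: e_def q_def k)
        finally show "(INF k. if e t k then ereal (q k) else \<infinity>) \<le> ereal t + ereal \<epsilon>" .
      qed
    qed
    then show ?thesis by (simp add: r_def)
  qed
  have "e \<in> restrict_space borel S \<rightarrow>\<^sub>M bit_space"
  proof (rule measurable_PiM_single')
    show "(\<lambda>t. e t k) \<in> restrict_space borel S \<rightarrow>\<^sub>M count_space UNIV" for k
      unfolding e_def by (rule measurable_restrict_space1) measurable
  qed simp
  moreover have "r \<in> borel_measurable bit_space"
    unfolding r_def by measurable
  then have "d \<in> borel_measurable bit_space"
    unfolding d_def using S(1) by measurable
  then have "d \<in> bit_space \<rightarrow>\<^sub>M restrict_space borel S"
    by (rule measurable_restrict_space2[rotated]) (simp add: d_def s)
  moreover have "d (e t) = t" if "t \<in> S" for t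
    using that by (simp add: d_def r_e)
  ultimately show ?thesis by (rule that)
qed

text \<open>\<open>F\<close> is transported to bit sequences along \<open>e\<close>, realised there
  by a measure, and sent back along \<open>d\<close>. Since \<open>d i (e i t) = t\<close>, pulling
  \<open>A i\<close> back along \<open>d i\<close> and then along \<open>e i\<close> returns
  \<open>A i\<close>.\<close>

lemma multimeasure_extension:
  fixes F :: "('i \<Rightarrow> 'b set) \<Rightarrow> real"
  assumes F: "prob_multimeasure I N F" and I: "finite I"
    and e: "\<And>i. i \<in> I \<Longrightarrow> e i \<in> N i \<rightarrow>\<^sub>M bit_space" and d: "\<And>i. i \<in> I \<Longrightarrow> d i \<in> bit_space \<rightarrow>\<^sub>M N i"
    and de: "\<And>i t. i \<in> I \<Longrightarrow> t \<in> space (N i) \<Longrightarrow> d i (e i t) = t"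
  obtains \<mu> where "prob_space \<mu>" "sets \<mu> = sets (PiM I N)"
    "\<And>A. (\<And>i. i \<in> I \<Longrightarrow> A i \<in> sets (N i)) \<Longrightarrow> measure \<mu> (PiE I A) = F A"
proof (cases "I = {}")
  case True
  \<comment> \<open>The product over no coordinates has a single point, and \<open>F\<close> is
    constantly 1.\<close>
  define \<mu> where "\<mu> = return (PiM I N) (\<lambda>_. undefined)"
  have "measure \<mu> (PiE I A) = F A" for A
  proof -
    have "F A = F (\<lambda>i. space (N i))" by (rule prob_multimeasureD(2)[OF F]) (simp add: True)
    also have "\<dots> = 1" by (rule prob_multimeasureD(3)[OF F])
    finally show ?thesis
      by (simp add: \<mu>_def True measure_return sets_PiM_empty)
  qed
  moreover have "prob_space \<mu>"
    unfolding \<mu>_def by (rule prob_space_return) (simp add: True space_PiM)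
  ultimately show ?thesis by (intro that[of \<mu>]) (simp_all add: \<mu>_def)
next
  case False
  have "prob_multimeasure I (\<lambda>_. bit_space) (\<lambda>C. F (\<lambda>i. e i -` C i \<inter> space (N i)))"
    using F e by (rule prob_multimeasure_vimage)
  from joint_bit_measure[OF this I False] obtain \<nu> and enc :: "'i \<times> nat \<Rightarrow> nat" where \<nu>: "prob_space \<nu>" "sets \<nu> = sets bit_space"
    "\<And>C. (\<And>i. i \<in> I \<Longrightarrow> C i \<in> sets bit_space) \<Longrightarrow>
      measure \<nu> {x. \<forall>i\<in>I. (\<lambda>k. x (enc (i, k))) \<in> C i} = F (\<lambda>i. e i -` C i \<inter> space (N i))"
    by blast
  define f where "f x = (\<lambda>i\<in>I. d i (\<lambda>k. x (enc (i, k))))" for x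
  have f: "f \<in> \<nu> \<rightarrow>\<^sub>M PiM I N"
    unfolding f_def
  proof (rule measurable_restrict)
    fix i assume i: "i \<in> I"
    have "(\<lambda>x k. x (enc (i, k))) \<in> bit_space \<rightarrow>\<^sub>M bit_space"
      by (rule measurable_PiM_single') simp_all
    then have "(\<lambda>x. d i (\<lambda>k. x (enc (i, k)))) \<in> bit_space \<rightarrow>\<^sub>M N i"
      by (rule measurable_compose[OF _ d[OF i]])
    then show "(\<lambda>x. d i (\<lambda>k. x (enc (i, k)))) \<in> \<nu> \<rightarrow>\<^sub>M N i"
      using measurable_cong_sets[OF \<nu>(2) refl] by blast
  qed
  have space_\<nu>: "space \<nu> = UNIV" and space_bit: "space bit_space = UNIV"
    using sets_eq_imp_space_eq[OF \<nu>(2)] by (simp_all add: space_PiM)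
  have "measure (distr \<nu> (PiM I N) f) (PiE I A) = F A" if A: "\<And>i. i \<in> I \<Longrightarrow> A i \<in> sets (N i)" for A
  proof -
    have dA: "d i -` A i \<in> sets bit_space" if "i \<in> I" for i
      using measurable_sets[OF d[OF that] A[OF that]] by (simp add: space_bit)
    have "measure (distr \<nu> (PiM I N) f) (PiE I A) = measure \<nu> (f -` PiE I A \<inter> space \<nu>)"
      using f by (rule measure_distr) (rule sets_PiM_I_finite[OF I A])
    also have "f -` PiE I A \<inter> space \<nu> = {x. \<forall>i\<in>I. (\<lambda>k. x (enc (i, k))) \<in> d i -` A i}"
      by (auto simp: f_def space_\<nu> PiE_def Pi_def)
    also have "measure \<nu> \<dots> = F (\<lambda>i. e i -` (d i -` A i) \<inter> space (N i))"
      using dA by (rule \<nu>(3))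
    also have "\<dots> = F A"
    proof (rule prob_multimeasureD(2)[OF F])
      fix i assume i: "i \<in> I"
      then show "e i -` (d i -` A i) \<inter> space (N i) = A i"
        using sets.sets_into_space[OF A[OF i]] by (auto simp: de)
    qed
    finally show ?thesis .
  qed
  then show ?thesis
    by (intro that[OF prob_space.prob_space_distr[OF \<nu>(1) f]]) simp_all
qed

lemma prob_measure_PiM_eqI:
  assumes "finite I" "sets \<mu> = sets (PiM I N)" "sets \<nu> = sets (PiM I N)" "prob_space \<mu>" "prob_space \<nu>"
    and eq: "\<And>A. (\<And>i. i \<in> I \<Longrightarrow> A i \<in> sets (N i)) \<Longrightarrow> measure \<mu> (PiE I A) = measure \<nu> (PiE I A)"
  shows "\<mu> = \<nu>"
proof (rule measure_eqI_PiM_finite[OF assms(1,2,3)])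
  interpret \<mu>: prob_space \<mu> by fact
  interpret \<nu>: prob_space \<nu> by fact
  show "emeasure \<mu> (PiE I A) = emeasure \<nu> (PiE I A)" if "\<And>i. i \<in> I \<Longrightarrow> A i \<in> sets (N i)" for A
    using eq[of A] that by (simp add: \<mu>.emeasure_eq_measure \<nu>.emeasure_eq_measure)
  show "range (\<lambda>_::nat. space (PiM I N)) \<subseteq> prod_algebra I N"
    using prod_algebraI_finite[OF assms(1), of "\<lambda>i. space (N i)" N] by (auto simp: space_PiM)
  show "emeasure \<mu> (space (PiM I N)) \<noteq> \<infinity>" by (simp add: \<mu>.emeasure_eq_measure)
qed simp

subsection \<open>Products of commuting projectors\<close>

lemma orthogonal_projectorD:
  assumes "orthogonal_projector Q"
  shows "bounded_clinear Q" "bounded_linear Q" "Q (Q x) = Q x" "cinner (Q x) y = cinner x (Q y)"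
    "cinner x (Q x) = complex_of_real ((norm (Q x))\<^sup>2)"
proof -
  show 1: "bounded_clinear Q" "Q (Q x) = Q x" "cinner (Q x) y = cinner x (Q y)" for x y
    using assms by (auto simp: orthogonal_projector_def fun_eq_iff)
  show "bounded_linear Q" by (rule bounded_clinearD(3)[OF 1(1)])
  show "cinner x (Q x) = complex_of_real ((norm (Q x))\<^sup>2)"
    by (metis 1(2,3) cinner_same)
qed

lemma orthogonal_projector_id: "orthogonal_projector id"
  by (auto simp: orthogonal_projector_def bounded_clinear_def id_def)

lemma orthogonal_projector_comp:
  assumes P: "orthogonal_projector P" and Q: "orthogonal_projector Q" and PQ: "P \<circ> Q = Q \<circ> P"
  shows "orthogonal_projector (P \<circ> Q)"
proof -
  have PQ': "P (Q x) = Q (P x)" for x using PQ by (metis comp_apply)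
  have "bounded_clinear (P \<circ> Q)"
    using orthogonal_projectorD(1)[OF P] orthogonal_projectorD(1)[OF Q]
    unfolding bounded_clinear_def comp_def by (auto intro: bounded_linear_compose)
  moreover have "cinner ((P \<circ> Q) x) y = cinner x ((P \<circ> Q) y)" for x y
    by (simp add: orthogonal_projectorD(4)[OF P] orthogonal_projectorD(4)[OF Q] PQ')
  moreover have "(P \<circ> Q) ((P \<circ> Q) x) = (P \<circ> Q) x" for x
    by (metis PQ' comp_apply orthogonal_projectorD(3)[OF P] orthogonal_projectorD(3)[OF Q])
  ultimately show ?thesis
    unfolding orthogonal_projector_def by (auto simp: fun_eq_iff)
qed

text \<open>The fold of \<open>projector_product\<close> with \<open>E i (A i)\<close> abstracted to
  \<open>f i\<close>, so that recursion on the index set concerns one fixed family of maps.\<close>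

definition comp_fold :: "('i \<Rightarrow> 'a \<Rightarrow> 'a) \<Rightarrow> 'i set \<Rightarrow> 'a \<Rightarrow> 'a" where
  "comp_fold f J = Finite_Set.fold (\<lambda>i T. f i \<circ> T) id J"

lemma comp_fold_empty [simp]: "comp_fold f {} = id"
  by (simp add: comp_fold_def)

lemma comp_fold_insert:
  assumes "finite J" "i \<notin> J"
    and "\<And>j k x. j \<in> insert i J \<Longrightarrow> k \<in> insert i J \<Longrightarrow> f j (f k x) = f k (f j x)"
  shows "comp_fold f (insert i J) = f i \<circ> comp_fold f J"
proof -
  interpret comp_fun_commute_on "insert i J" "\<lambda>i T. f i \<circ> T"
  proof
    fix j k assume jk: "j \<in> insert i J" "k \<in> insert i J"
    show "(\<circ>) (f k) \<circ> (\<circ>) (f j) = (\<circ>) (f j) \<circ> (\<circ>) (f k)"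
      by (intro ext) (simp add: assms(3)[OF jk])
  qed
  show ?thesis unfolding comp_fold_def using assms(1,2) by (intro fold_insert) auto
qed

lemma comp_fold_cong: "(\<And>j. j \<in> J \<Longrightarrow> f j = g j) \<Longrightarrow> comp_fold f J = comp_fold g J"
  unfolding comp_fold_def by (rule fold_closed_eq[where B = UNIV]) auto

lemma comp_fold_commute:
  assumes "finite J" "\<And>j k x. j \<in> J \<Longrightarrow> k \<in> J \<Longrightarrow> f j (f k x) = f k (f j x)"
    and "\<And>j x. j \<in> J \<Longrightarrow> g (f j x) = f j (g x)"
  shows "g (comp_fold f J x) = comp_fold f J (g x)"
  using assms
proof (induction J rule: finite_induct)
  case (insert i J)
  have "comp_fold f (insert i J) = f i \<circ> comp_fold f J"
    using insert.hyps insert.prems(1) by (rule comp_fold_insert)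
  then show ?case using insert by simp
qed simp

lemma orthogonal_projector_comp_fold:
  assumes "finite J" "\<And>j. j \<in> J \<Longrightarrow> orthogonal_projector (f j)"
    and "\<And>j k x. j \<in> J \<Longrightarrow> k \<in> J \<Longrightarrow> f j (f k x) = f k (f j x)"
  shows "orthogonal_projector (comp_fold f J)"
  using assms
proof (induction J rule: finite_induct)
  case empty
  show ?case unfolding comp_fold_empty by (rule orthogonal_projector_id)
next
  case (insert i J)
  have fold: "comp_fold f (insert i J) = f i \<circ> comp_fold f J"
    using insert.hyps insert.prems(2) by (rule comp_fold_insert)
  have "f i (comp_fold f J x) = comp_fold f J (f i x)" for x
    by (rule comp_fold_commute) (use insert in auto)
  then show ?case
    unfolding fold using insert.IH insert.prems
    by (intro orthogonal_projector_comp) (auto simp: fun_eq_iff)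
qed

lemma comp_fold_id: "finite J \<Longrightarrow> comp_fold (\<lambda>_ x. x) J x = x"
proof (induction J rule: finite_induct)
  case (insert i J)
  have "comp_fold (\<lambda>_ x. x) (insert i J) = (\<lambda>x. x) \<circ> comp_fold (\<lambda>_ x. x) J"
    by (rule comp_fold_insert) (use insert.hyps in auto)
  from fun_cong[OF this, of x] insert.IH show ?case by (simp only: comp_apply)
qed simp

section \<open>The trace of a product of projectors as a multimeasure\<close>

lemma projector_product_eq: "projector_product E \<eta> A = comp_fold (\<lambda>i. E i (A i)) {i. \<eta> i}"
  by (simp add: projector_product_def comp_fold_def)

lemma projector_product_cong:
  assumes "\<And>i. \<eta> i \<Longrightarrow> A i = B i"
  shows "projector_product E \<eta> A = projector_product E \<eta> B"
  unfolding projector_product_eq by (rule comp_fold_cong) (simp add: assms)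

text \<open>Each term of the rank-one expansion is the squared norm of
  \<open>Q (w n)\<close>.\<close>

lemma density_trace_projector:
  assumes "density_operator W" "orthogonal_projector Q"
  shows "operator_trace (W \<circ> Q) = of_real (Re (operator_trace (W \<circ> Q)))" "0 \<le> Re (operator_trace (W \<circ> Q))"
proof -
  obtain w :: "nat \<Rightarrow> 'a" where
    "((\<lambda>n. cinner (w n) (Q (w n))) has_sum operator_trace (W \<circ> Q)) UNIV"
    using density_operator_decomposition[OF assms(1)] assms(2) by metis
  then have sum: "((\<lambda>n. complex_of_real ((norm (Q (w n)))\<^sup>2)) has_sum operator_trace (W \<circ> Q)) UNIV"
    by (simp only: orthogonal_projectorD(5)[OF assms(2)])
  from has_sum_Im[OF sum] have "((\<lambda>n::nat. 0 :: real) has_sum Im (operator_trace (W \<circ> Q))) UNIV"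
    by (simp only: Im_complex_of_real)
  then have "Im (operator_trace (W \<circ> Q)) = 0"
    using has_sum_unique has_sum_0_simp by blast
  then show "operator_trace (W \<circ> Q) = of_real (Re (operator_trace (W \<circ> Q)))"
    by (simp add: complex_eq_iff)
  from has_sum_Re[OF sum] show "0 \<le> Re (operator_trace (W \<circ> Q))"
    by (rule has_sum_nonneg) simp
qed

text \<open>For a projector, \<open>cinner x (R k x)\<close> is the squared norm of
  \<open>R k x\<close>, so convergence of the vectors makes these squared norms sum to that of
  \<open>Q x\<close>. Taking \<open>x = w n\<close>, summing over \<open>n\<close> and exchanging
  sums of nonnegative terms gives the traces.\<close>

lemma density_trace_sums:
  assumes W: "density_operator W" and Q: "orthogonal_projector Q" "\<And>k. orthogonal_projector (R k)"
    and sums: "\<And>x. (\<lambda>k. R k x) sums Q x"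
  shows "(\<lambda>k. Re (operator_trace (W \<circ> R k))) sums Re (operator_trace (W \<circ> Q))"
proof -
  obtain w :: "nat \<Rightarrow> 'a" where
    w: "\<And>Q. orthogonal_projector Q \<Longrightarrow>
      ((\<lambda>n. cinner (w n) (Q (w n))) has_sum operator_trace (W \<circ> Q)) UNIV"
    using density_operator_decomposition[OF W] by metis
  have w': "((\<lambda>n. (norm (T (w n)))\<^sup>2) has_sum Re (operator_trace (W \<circ> T))) UNIV"
    if "orthogonal_projector T" for T
    using has_sum_Re[OF w[OF that]] by (simp only: orthogonal_projectorD(5)[OF that] Re_complex_of_real)
  have row: "((\<lambda>k. (norm (R k x))\<^sup>2) has_sum (norm (Q x))\<^sup>2) UNIV" for x
  proof (rule sums_nonneg_imp_has_sum)
    have "(\<lambda>k. Re (cinner x (R k x))) sums Re (cinner x (Q x))"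
      using sums bounded_linear.sums bounded_linear_cinner_right sums_Re by blast
    then show "(\<lambda>k. (norm (R k x))\<^sup>2) sums (norm (Q x))\<^sup>2"
      by (simp only: orthogonal_projectorD(5)[OF Q(1)] orthogonal_projectorD(5)[OF Q(2)] Re_complex_of_real)
  qed simp
  have "(\<lambda>(n, k). (norm (R k (w n)))\<^sup>2) summable_on UNIV \<times> UNIV"
    using row w'[OF Q(1)]
    by (intro summable_on_SigmaI[where g = "\<lambda>n. (norm (Q (w n)))\<^sup>2"]) (auto simp: summable_on_def)
  then have "((\<lambda>k. Re (operator_trace (W \<circ> R k))) has_sum Re (operator_trace (W \<circ> Q))) UNIV"
    using row w'[OF Q(2)] w'[OF Q(1)] by (rule has_sum_double_swap)
  then show ?thesis by (rule has_sum_imp_sums)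
qed

lemma orthogonal_projector_product:
  fixes N :: "'n::finite \<Rightarrow> real measure"
  assumes E: "\<And>i. projection_valued_measure (N i) (E i)"
    and comm: "\<And>i j A B. \<eta> i \<Longrightarrow> \<eta> j \<Longrightarrow> A \<in> sets (N i) \<Longrightarrow> B \<in> sets (N j) \<Longrightarrow>
      E i A \<circ> E j B = E j B \<circ> E i A"
    and A: "\<And>i. \<eta> i \<Longrightarrow> A i \<in> sets (N i)"
  shows "orthogonal_projector (projector_product E \<eta> A)"
proof -
  have "orthogonal_projector (E i (A i))" if "\<eta> i" for i
    using E[of i] A[OF that] by (simp add: projection_valued_measure_def)
  moreover have "E i (A i) (E j (A j) x) = E j (A j) (E i (A i) x)" if "\<eta> i" "\<eta> j" for i j x
    using comm[OF that A[OF that(1)] A[OF that(2)]] by (metis comp_apply)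
  ultimately show ?thesis
    unfolding projector_product_eq by (intro orthogonal_projector_comp_fold) auto
qed

text \<open>By commutation the factor with index \<open>i\<close> can be brought to the front,
  leaving a product \<open>R\<close> that does not involve side \<open>i\<close>. Countable
  additivity in this side is then that of \<open>E i\<close> at the vectors \<open>R x\<close>,
  passed to the trace by \<open>density_trace_sums\<close>.\<close>

lemma prob_multimeasure_trace:
  fixes W :: "'a::complex_hilbert_space \<Rightarrow> 'a" and N :: "'n::finite \<Rightarrow> real measure"
  assumes W: "density_operator W" and E: "\<And>i. projection_valued_measure (N i) (E i)"
    and comm: "\<And>i j A B. \<eta> i \<Longrightarrow> \<eta> j \<Longrightarrow> A \<in> sets (N i) \<Longrightarrow> B \<in> sets (N j) \<Longrightarrow>
      E i A \<circ> E j B = E j B \<circ> E i A"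
  shows "prob_multimeasure {i. \<eta> i} N (\<lambda>A. Re (operator_trace (W \<circ> projector_product E \<eta> A)))"
  unfolding prob_multimeasure_def
proof (intro conjI allI impI)
  note orth = orthogonal_projector_product[OF E comm]
  fix A B :: "'n \<Rightarrow> real set"
  show "0 \<le> Re (operator_trace (W \<circ> projector_product E \<eta> A))" if "\<forall>i\<in>{i. \<eta> i}. A i \<in> sets (N i)"
    by (rule density_trace_projector(2)[OF W]) (rule orth, use that in auto)
  show "Re (operator_trace (W \<circ> projector_product E \<eta> A)) = Re (operator_trace (W \<circ> projector_product E \<eta> B))"
    if "\<forall>i\<in>{i. \<eta> i}. A i = B i"
    using projector_product_cong[of \<eta> A B E] that by simp
  have "comp_fold (\<lambda>i. E i (space (N i))) {i. \<eta> i} = comp_fold (\<lambda>_ x. x) {i. \<eta> i}"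
    by (rule comp_fold_cong) (use E in \<open>simp add: projection_valued_measure_def id_def\<close>)
  then have "projector_product E \<eta> (\<lambda>i. space (N i)) = id"
    by (simp add: projector_product_eq fun_eq_iff comp_fold_id)
  then show "Re (operator_trace (W \<circ> projector_product E \<eta> (\<lambda>i. space (N i)))) = 1"
    using W by (simp add: density_operator_def)
  fix i and G :: "nat \<Rightarrow> real set"
  assume A: "\<forall>j\<in>{i. \<eta> i}. A j \<in> sets (N j)" and "i \<in> {i. \<eta> i}"
    and G: "range G \<subseteq> sets (N i)" "disjoint_family G"
  then have i: "\<eta> i" and A': "\<And>j. \<eta> j \<Longrightarrow> A j \<in> sets (N j)" by auto
  define R where "R = comp_fold (\<lambda>j. E j (A j)) ({i. \<eta> i} - {i})"
  have split: "projector_product E \<eta> (A(i := X)) = E i X \<circ> R" if X: "X \<in> sets (N i)" for X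
  proof -
    define f where "f j = E j ((A(i := X)) j)" for j
    have AX: "(A(i := X)) j \<in> sets (N j)" if "\<eta> j" for j using X A' that by simp
    have "projector_product E \<eta> (A(i := X)) = comp_fold f (insert i ({i. \<eta> i} - {i}))"
      unfolding projector_product_eq f_def using i by (simp add: insert_absorb)
    also have "\<dots> = f i \<circ> comp_fold f ({i. \<eta> i} - {i})"
    proof (rule comp_fold_insert)
      fix j k x assume "j \<in> insert i ({i. \<eta> i} - {i})" "k \<in> insert i ({i. \<eta> i} - {i})"
      then have "\<eta> j" "\<eta> k" using i by auto
      from comm[OF this AX[OF this(1)] AX[OF this(2)]] show "f j (f k x) = f k (f j x)"
        unfolding f_def by (metis comp_apply)
    qed auto
    also have "comp_fold f ({i. \<eta> i} - {i}) = R"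
      unfolding R_def by (rule comp_fold_cong) (simp add: f_def)
    finally show ?thesis by (simp only: f_def fun_upd_same)
  qed
  have orth': "orthogonal_projector (projector_product E \<eta> (A(i := X)))" if "X \<in> sets (N i)" for X
    by (rule orth) (use that A' in auto)
  have GN: "G k \<in> sets (N i)" "(\<Union>k. G k) \<in> sets (N i)" for k
    using G(1) by auto
  show "(\<lambda>n. Re (operator_trace (W \<circ> projector_product E \<eta> (A(i := G n))))) sums
      Re (operator_trace (W \<circ> projector_product E \<eta> (A(i := \<Union>n. G n))))"
  proof (rule density_trace_sums[OF W orth'[OF GN(2)] orth'[OF GN(1)]])
    have "(\<lambda>k. E i (G k) (R x)) sums E i (\<Union>k. G k) (R x)" for x
      using E[of i] G unfolding projection_valued_measure_def by blast
    then show "(\<lambda>k. projector_product E \<eta> (A(i := G k)) x) sums projector_product E \<eta> (A(i := \<Union>k. G k)) x" for x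
      by (simp only: split[OF GN(1)] split[OF GN(2)] comp_apply)
  qed
qed

text \<open>On an empty spectrum the projector of the empty set would be both 0 and the identity;
  the Hilbert space would be trivial and \<open>W\<close> could not have trace 1. The point so
  obtained is the fallback value that \<open>borel_coding\<close> needs.\<close>

lemma spectrum_nonempty:
  fixes W :: "'a::complex_hilbert_space \<Rightarrow> 'a" and E :: "real set \<Rightarrow> 'a \<Rightarrow> 'a"
  assumes W: "density_operator W" and E: "projection_valued_measure (spectrum_borel T) E"
  shows "{t. complex_of_real t \<in> spectrum T} \<noteq> {}"
proof
  assume empty: "{t. complex_of_real t \<in> spectrum T} = {}"
  have zero: "x = (0::'a)" for x
  proof -
    have id: "E {} = id"
      using E empty by (simp add: projection_valued_measure_def space_spectrum_borel)
    have "(\<lambda>n::nat. E {} x) sums E (\<Union>n::nat. {}) x"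
      using E[unfolded projection_valued_measure_def, THEN conjunct2, THEN conjunct2, THEN conjunct2,
          rule_format, of "\<lambda>_. {}"]
      by (simp add: disjoint_family_on_def)
    then have "E {} x = 0" using sums_summable summable_const_iff by blast
    then show ?thesis by (simp add: id)
  qed
  have "W b = 0" for b by (rule zero)
  then have "operator_trace W = 0" by (simp add: operator_trace_def)
  with W show False by (simp add: density_operator_def)
qed

subsection \<open>Joint distributions\<close>

text \<open>Rectangles form an intersection-stable generator, so at most one probability measure has
  the prescribed values, and the definite description denotes any measure that has them.\<close>

lemma joint_distribution_eqI:
  assumes \<mu>: "prob_space \<mu>" "sets \<mu> = sets (\<Pi>\<^sub>M i\<in>{i. \<eta> i}. spectrum_borel (M i))"
    and meas: "\<And>A. borel_family M \<eta> A \<Longrightarrow>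
      complex_of_real (measure \<mu> (outcome_event \<eta> A)) = operator_trace (W \<circ> projector_product E \<eta> A)"
  shows "joint_distribution W M E \<eta> = \<mu>"
  unfolding joint_distribution_def
proof (rule the_equality)
  fix \<nu>
  assume \<nu>: "prob_space \<nu> \<and> sets \<nu> = sets (\<Pi>\<^sub>M i\<in>{i. \<eta> i}. spectrum_borel (M i)) \<and>
    (\<forall>A. borel_family M \<eta> A \<longrightarrow>
      complex_of_real (measure \<nu> (outcome_event \<eta> A)) = operator_trace (W \<circ> projector_product E \<eta> A))"
  have "measure \<nu> (\<Pi>\<^sub>E i\<in>{i. \<eta> i}. A i) = measure \<mu> (\<Pi>\<^sub>E i\<in>{i. \<eta> i}. A i)"
    if "\<And>i. i \<in> {i. \<eta> i} \<Longrightarrow> A i \<in> sets (spectrum_borel (M i))" for A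
  proof -
    have "borel_family M \<eta> A" using that by (simp add: borel_family_def)
    then have "complex_of_real (measure \<nu> (outcome_event \<eta> A)) = complex_of_real (measure \<mu> (outcome_event \<eta> A))"
      using \<nu> meas by simp
    then show ?thesis by (simp add: outcome_event_def)
  qed
  then show "\<nu> = \<mu>"
    using \<mu> \<nu> by (intro prob_measure_PiM_eqI[of "{i. \<eta> i}" \<nu> "\<lambda>i. spectrum_borel (M i)" \<mu>]) auto
qed (use assms in blast)

lemma joint_distribution:
  fixes W :: "'a::complex_hilbert_space \<Rightarrow> 'a" and M :: "'n::finite \<Rightarrow> 'a \<rightharpoonup> 'a"
  assumes W: "density_operator W" and E: "\<And>i. spectral_measure (M i) (E i)"
    and comm: "\<forall>i j. \<eta> i \<longrightarrow> \<eta> j \<longrightarrow> operators_commute (M i) (M j)"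
  shows "prob_space (joint_distribution W M E \<eta>)"
    and "sets (joint_distribution W M E \<eta>) = sets (\<Pi>\<^sub>M i\<in>{i. \<eta> i}. spectrum_borel (M i))"
    and "\<And>A. borel_family M \<eta> A \<Longrightarrow>
      complex_of_real (measure (joint_distribution W M E \<eta>) (outcome_event \<eta> A)) =
        operator_trace (W \<circ> projector_product E \<eta> A)"
proof -
  define N where "N i = spectrum_borel (M i)" for i
  define S where "S i = {t. complex_of_real t \<in> spectrum (M i)}" for i
  have N: "N i = restrict_space borel (S i)" for i
    by (simp add: N_def S_def spectrum_borel_def)
  have space_N: "space (N i) = S i" for i
    by (simp add: N space_restrict_space)
  have pvm: "projection_valued_measure (N i) (E i)" for i
    using E by (simp add: N_def spectral_measure_def)
  have commE: "E i A \<circ> E j B = E j B \<circ> E i A"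
    if "\<eta> i" "\<eta> j" "A \<in> sets (N i)" "B \<in> sets (N j)" for i j A B
    using comm that E unfolding operators_commute_def N_def by blast
  define F where "F A = Re (operator_trace (W \<circ> projector_product E \<eta> A))" for A
  have F: "prob_multimeasure {i. \<eta> i} N F"
    unfolding F_def using W pvm commE by (rule prob_multimeasure_trace)
  have "\<exists>e d. e \<in> N i \<rightarrow>\<^sub>M bit_space \<and> d \<in> bit_space \<rightarrow>\<^sub>M N i \<and> (\<forall>t\<in>space (N i). d (e t) = t)" for i
  proof -
    have "S i \<in> sets borel"
      unfolding S_def by (rule borel_closed[OF closed_real_spectrum])
    moreover have "S i \<noteq> {}"
      unfolding S_def using W pvm[of i] unfolding N_def by (rule spectrum_nonempty)
    ultimately obtain e d where "e \<in> restrict_space borel (S i) \<rightarrow>\<^sub>M bit_space"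
        "d \<in> bit_space \<rightarrow>\<^sub>M restrict_space borel (S i)" "\<And>t. t \<in> S i \<Longrightarrow> d (e t) = t"
      using borel_coding[of "S i"] by blast
    then show ?thesis unfolding space_N unfolding N by blast
  qed
  then obtain e d where ed: "\<And>i. e i \<in> N i \<rightarrow>\<^sub>M bit_space" "\<And>i. d i \<in> bit_space \<rightarrow>\<^sub>M N i"
      "\<And>i t. t \<in> space (N i) \<Longrightarrow> d i (e i t) = t"
    by metis
  from multimeasure_extension[OF F finite ed(1) ed(2) ed(3)] obtain \<mu> where \<mu>: "prob_space \<mu>" "sets \<mu> = sets (PiM {i. \<eta> i} N)"
    "\<And>A. (\<And>i. i \<in> {i. \<eta> i} \<Longrightarrow> A i \<in> sets (N i)) \<Longrightarrow> measure \<mu> (PiE {i. \<eta> i} A) = F A"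
    by blast
  have trace: "complex_of_real (measure \<mu> (outcome_event \<eta> A)) = operator_trace (W \<circ> projector_product E \<eta> A)"
    if A: "borel_family M \<eta> A" for A
  proof -
    have AN: "A i \<in> sets (N i)" if "\<eta> i" for i
      using A that by (simp add: borel_family_def N_def)
    then have "measure \<mu> (outcome_event \<eta> A) = F A"
      unfolding outcome_event_def by (intro \<mu>(3)) simp
    moreover have "operator_trace (W \<circ> projector_product E \<eta> A) = of_real (F A)"
      unfolding F_def
      by (rule density_trace_projector(1)[OF W orthogonal_projector_product[OF pvm commE AN]])
    ultimately show ?thesis by simp
  qed
  have eq: "joint_distribution W M E \<eta> = \<mu>"
    using \<mu>(1) \<mu>(2)[unfolded N_def[abs_def]] trace by (rule joint_distribution_eqI)
  show "prob_space (joint_distribution W M E \<eta>)" unfolding eq by (rule \<mu>(1))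
  show "sets (joint_distribution W M E \<eta>) = sets (\<Pi>\<^sub>M i\<in>{i. \<eta> i}. spectrum_borel (M i))"
    unfolding eq using \<mu>(2) by (simp add: N_def[abs_def])
  show "complex_of_real (measure (joint_distribution W M E \<eta>) (outcome_event \<eta> A)) =
      operator_trace (W \<circ> projector_product E \<eta> A)" if "borel_family M \<eta> A" for A
    unfolding eq using that by (rule trace)
qed

text \<open>The first component of a point carries the outcomes, the second the conditioning vector
  \<open>\<eta>\<close>: first \<open>\<eta>\<close> is drawn with distribution \<open>P\<close>, then the outcomes with distribution \<open>\<mu> \<eta>\<close>.\<close>

lemma conditional_mixture:
  fixes P :: "('n::finite \<Rightarrow> bool) measure" and \<mu> :: "('n \<Rightarrow> bool) \<Rightarrow> ('n \<Rightarrow> real) measure"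
  assumes P: "prob_space P" "sets P = Pow UNIV"
    and \<mu>: "\<And>\<eta>. measure P {\<eta>} \<noteq> 0 \<Longrightarrow> prob_space (\<mu> \<eta>)"
    and sets_\<mu>: "\<And>\<eta>. measure P {\<eta>} \<noteq> 0 \<Longrightarrow> sets (\<mu> \<eta>) = sets (\<Pi>\<^sub>M i\<in>{i. \<eta> i}. restrict_space borel (S i))"
  defines "vec_of \<eta> \<equiv> (\<chi> i. of_bool (\<eta> i)) :: real^'n"
  obtains p :: "((real^'n) \<times> (real^'n)) measure" where "prob_space p" "sets p = sets borel"
    "\<And>C. UNIV \<times> vec_of ` C \<in> sets borel"
    "\<And>C. measure p (UNIV \<times> vec_of ` C) = measure P C"
    "\<And>\<eta> R. measure P {\<eta>} \<noteq> 0 \<Longrightarrow> {x. restrict (\<lambda>i. x $ i) {i. \<eta> i} \<in> R} \<in> sets borel \<Longrightarrow>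
      R \<in> sets (\<mu> \<eta>) \<Longrightarrow>
      measure p (({x. restrict (\<lambda>i. x $ i) {i. \<eta> i} \<in> R} \<times> UNIV) \<inter> (UNIV \<times> vec_of ` {\<eta>})) =
        measure (\<mu> \<eta>) R * measure P {\<eta>}"
proof -
  interpret P: prob_space P by fact
  have space_P: "space P = UNIV"
    using sets_eq_imp_space_eq[of P "count_space UNIV"] P(2) by simp
  have meas_P: "measurable P L = measurable (count_space UNIV) L" for L :: "'z measure"
    by (rule measurable_cong_sets) (simp_all add: P(2))
  have vec_of_eq: "vec_of \<eta> = vec_of \<eta>' \<longleftrightarrow> \<eta> = \<eta>'" for \<eta> \<eta>'
    by (auto simp: vec_of_def vec_eq_iff fun_eq_iff of_bool_eq_iff)
  \<comment> \<open>Unmeasured coordinates are filled with 0 to obtain a vector; restriction to the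
    measured ones recovers the extensional function \<open>f\<close>.\<close>
  define h where "h \<eta> f = ((\<chi> i. if \<eta> i then f i else 0) :: real^'n, vec_of \<eta>)" for \<eta> and f :: "'n \<Rightarrow> real"
  \<comment> \<open>The point mass at a null \<eta> still lies over \<open>vec_of \<eta>\<close>, so
    \<open>K\<close> is a probability kernel everywhere and conditioning events have the right value
    on every fibre.\<close>
  define K where "K \<eta> = (if measure P {\<eta>} \<noteq> 0 then distr (\<mu> \<eta>) borel (h \<eta>) else return borel (0, vec_of \<eta>))" for \<eta>
  have h: "h \<eta> \<in> \<mu> \<eta> \<rightarrow>\<^sub>M borel" if "measure P {\<eta>} \<noteq> 0" for \<eta>
  proof -
    have coord: "(\<lambda>f. if \<eta> i then f i else 0) \<in> borel_measurable (\<mu> \<eta>)" for i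
    proof (cases "\<eta> i")
      case True
      have "(\<lambda>f. f i) \<in> (\<Pi>\<^sub>M i\<in>{i. \<eta> i}. restrict_space borel (S i)) \<rightarrow>\<^sub>M restrict_space borel (S i)"
        using True by (intro measurable_component_singleton) simp
      then have "(\<lambda>f. f i) \<in> borel_measurable (\<Pi>\<^sub>M i\<in>{i. \<eta> i}. restrict_space borel (S i))"
        by (simp add: measurable_restrict_space2_iff)
      then have "(\<lambda>f. f i) \<in> borel_measurable (\<mu> \<eta>)"
        using measurable_cong_sets[OF sets_\<mu>[OF that] refl] by blast
      then show ?thesis using True by simp
    qed simp
    have "(\<lambda>f. (\<chi> i. if \<eta> i then f i else 0) :: real^'n) \<in> borel_measurable (\<mu> \<eta>)"
    proof (rule borel_measurable_euclidean_space[THEN iffD2], rule ballI)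
      fix b :: "real^'n" assume "b \<in> Basis"
      then obtain i where "b = axis i 1" by (auto simp: Basis_vec_def)
      then show "(\<lambda>f. ((\<chi> i. if \<eta> i then f i else 0) :: real^'n) \<bullet> b) \<in> borel_measurable (\<mu> \<eta>)"
        using coord[of i] by (simp add: inner_axis)
    qed
    then show ?thesis unfolding h_def by (intro borel_measurable_Pair) simp_all
  qed
  have K_prob: "prob_space (K \<eta>)" and K_sets: "sets (K \<eta>) = sets borel" for \<eta>
    using prob_space.prob_space_distr[OF \<mu> h, of \<eta>] by (auto simp: K_def prob_space_return)
  \<comment> \<open>Every subset is measurable for \<open>P\<close>, so it only remains to see that
    each \<open>K \<eta>\<close> is a Borel probability measure.\<close>
  have K: "K \<in> P \<rightarrow>\<^sub>M prob_algebra borel"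
    unfolding meas_P using K_prob K_sets by (simp add: space_prob_algebra)
  then have K': "K \<in> P \<rightarrow>\<^sub>M subprob_algebra borel"
    by (rule measurable_prob_algebraD)
  define p where "p = P \<bind> K"
  have p: "prob_space p"
    unfolding p_def by (rule P.prob_space_bind[OF _ K']) (simp add: K_prob)
  have sets_p: "sets p = sets borel"
    unfolding p_def using K_sets by (rule sets_bind) (simp add: space_P)
  have measure_p: "measure p X = (\<integral>\<eta>. measure (K \<eta>) X \<partial>P)" if "X \<in> sets borel" for X
    unfolding p_def by (rule P.measure_bind[OF K' that])
  have cond: "UNIV \<times> vec_of ` C \<in> sets borel" for C
    by (intro borel_closed closed_Times closed_UNIV finite_imp_closed) simp
  have measure_K: "measure (K \<eta>) X = (if measure P {\<eta>} \<noteq> 0 then measure (\<mu> \<eta>) (h \<eta> -` X \<inter> space (\<mu> \<eta>))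
      else indicator X (0, vec_of \<eta>))" if "X \<in> sets borel" for X \<eta>
    using that h[of \<eta>] by (auto simp: K_def measure_distr measure_return)
  have "measure p (UNIV \<times> vec_of ` C) = measure P C" for C
  proof -
    have "measure (K \<eta>) (UNIV \<times> vec_of ` C) = indicator C \<eta>" for \<eta>
    proof -
      have "h \<eta> -` (UNIV \<times> vec_of ` C) = (if \<eta> \<in> C then UNIV else {})"
        using vec_of_eq by (auto simp: h_def)
      moreover have "indicator (UNIV \<times> vec_of ` C) (0 :: real^'n, vec_of \<eta>) = (indicator C \<eta> :: real)"
        using vec_of_eq by (auto simp: indicator_def)
      ultimately show ?thesis
        unfolding measure_K[OF cond] using prob_space.prob_space[OF \<mu>, of \<eta>] by simp
    qed
    then show ?thesis using measure_p[OF cond, of C] by (simp add: P(2))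
  qed
  moreover have "measure p (({x. restrict (\<lambda>i. x $ i) {i. \<eta> i} \<in> R} \<times> UNIV) \<inter> (UNIV \<times> vec_of ` {\<eta>})) =
      measure (\<mu> \<eta>) R * measure P {\<eta>}"
    if nz: "measure P {\<eta>} \<noteq> 0" and meas: "{x. restrict (\<lambda>i. x $ i) {i. \<eta> i} \<in> R} \<in> sets borel"
      and R: "R \<in> sets (\<mu> \<eta>)" for \<eta> R
  proof -
    define X where "X = ({x :: real^'n. restrict (\<lambda>i. x $ i) {i. \<eta> i} \<in> R} \<times> UNIV) \<inter> (UNIV \<times> vec_of ` {\<eta>})"
    have X: "X \<in> sets borel"
      unfolding X_def using cond[of "{\<eta>}"] borel_Times[OF meas, of UNIV] by (intro sets.Int) simp_all
    \<comment> \<open>The second component pins the conditioning vector, so only the fibre of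
      \<open>\<eta>\<close> contributes.\<close>
    have "measure (K \<eta>') X = indicator {\<eta>} \<eta>' * measure (\<mu> \<eta>) R" for \<eta>'
    proof (cases "\<eta>' = \<eta>")
      case True
      have mem_X: "z \<in> X \<longleftrightarrow> restrict (\<lambda>i. fst z $ i) {i. \<eta> i} \<in> R \<and> snd z = vec_of \<eta>" for z
        by (cases z) (simp add: X_def)
      have restr: "restrict (\<lambda>i. fst (h \<eta> f) $ i) {i. \<eta> i} = f" if "f \<in> space (\<mu> \<eta>)" for f
        using that sets_eq_imp_space_eq[OF sets_\<mu>[OF nz]]
        by (auto simp: h_def space_PiM PiE_def extensional_def fun_eq_iff)
      have "snd (h \<eta> f) = vec_of \<eta>" for f
        by (simp add: h_def)
      then have "h \<eta> f \<in> X \<longleftrightarrow> f \<in> R" if "f \<in> space (\<mu> \<eta>)" for f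
        unfolding mem_X restr[OF that] by simp
      then have "h \<eta> -` X \<inter> space (\<mu> \<eta>) = R"
        using sets.sets_into_space[OF R] by blast
      then show ?thesis using True nz by (simp add: measure_K[OF X])
    next
      case False
      then have "h \<eta>' -` X = {}" "(0, vec_of \<eta>') \<notin> X"
        using vec_of_eq by (auto simp: h_def X_def)
      then show ?thesis using False by (simp add: measure_K[OF X])
    qed
    then have "measure p X = (\<integral>\<eta>'. indicator {\<eta>} \<eta>' * measure (\<mu> \<eta>) R \<partial>P)"
      by (simp add: measure_p[OF X])
    also have "\<dots> = measure (\<mu> \<eta>) R * measure P {\<eta>}"
      by (simp add: P(2) space_P)
    finally show ?thesis by (simp only: X_def)
  qed
  ultimately show ?thesis
    using p sets_p cond by (intro that[of p]) auto
qed

text \<open>The fibre of \<eta> carries its joint distribution scaled by the probability of \<eta>,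
  and this factor cancels in the quotient.\<close>

theorem theorem4:
  fixes W :: "'a::complex_hilbert_space \<Rightarrow> 'a"
    and M :: "'n::finite \<Rightarrow> 'a \<rightharpoonup> 'a"
    and E :: "'n \<Rightarrow> real set \<Rightarrow> 'a \<Rightarrow> 'a"
    and P :: "('n \<Rightarrow> bool) measure"
  assumes "density_operator W"
    and "\<And>i. self_adjoint (M i)"
    and "\<And>i. spectral_measure (M i) (E i)"
    and "prob_space P" and "sets P = Pow UNIV"
    and "\<And>\<eta>. measure P {\<eta>} \<noteq> 0 \<Longrightarrow> (\<forall>i j. \<eta> i \<longrightarrow> \<eta> j \<longrightarrow> operators_commute (M i) (M j))"
  shows "\<exists>(S :: ((real^'n) \<times> (real^'n)) set) (p :: ((real^'n) \<times> (real^'n)) measure)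
            (X_cond :: ('n \<Rightarrow> bool) set \<Rightarrow> ((real^'n) \<times> (real^'n)) set)
            (X_out :: ('n \<Rightarrow> bool) \<Rightarrow> ('n \<Rightarrow> real) set \<Rightarrow> ((real^'n) \<times> (real^'n)) set).
      prob_space p \<and> sets p = sets (restrict_space borel S) \<and>
      (\<forall>C. X_cond C \<in> sets p) \<and>
      (\<forall>\<eta> A. borel_family M \<eta> A \<longrightarrow> X_out \<eta> (outcome_event \<eta> A) \<in> sets p) \<and>
      (\<forall>C. measure P C = measure p (X_cond C)) \<and>
      (\<forall>\<eta> A. measure P {\<eta>} \<noteq> 0 \<longrightarrow> borel_family M \<eta> A \<longrightarrow>
         complex_of_real (measure (joint_distribution W M E \<eta>) (outcome_event \<eta> A)) =
           operator_trace (W \<circ> projector_product E \<eta> A) \<and>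
         operator_trace (W \<circ> projector_product E \<eta> A) =
           complex_of_real (measure p (X_out \<eta> (outcome_event \<eta> A) \<inter> X_cond {\<eta>}) /
                            measure p (X_cond {\<eta>})))"
proof -
  note joint = joint_distribution[OF assms(1,3,6)]
  define vec_of :: "('n \<Rightarrow> bool) \<Rightarrow> real^'n" where "vec_of \<eta> = (\<chi> i. of_bool (\<eta> i))" for \<eta>
  define X_cond where "X_cond C = (UNIV :: (real^'n) set) \<times> vec_of ` C" for C
  \<comment> \<open>An outcome event restricts only the measured coordinates of the first component;
    the conditioning vector enters through the intersection with \<open>X_cond\<close>.\<close>
  define out where "out \<eta> R = {x :: real^'n. restrict (\<lambda>i. x $ i) {i. \<eta> i} \<in> R}" for \<eta> R
  define X_out where "X_out \<eta> R = out \<eta> R \<times> (UNIV :: (real^'n) set)" for \<eta> R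
  obtain p :: "((real^'n) \<times> (real^'n)) measure" where p: "prob_space p" "sets p = sets borel"
      "\<And>C. X_cond C \<in> sets borel" "\<And>C. measure p (X_cond C) = measure P C"
      "\<And>\<eta> R. measure P {\<eta>} \<noteq> 0 \<Longrightarrow> out \<eta> R \<in> sets borel \<Longrightarrow> R \<in> sets (joint_distribution W M E \<eta>) \<Longrightarrow>
        measure p (X_out \<eta> R \<inter> X_cond {\<eta>}) = measure (joint_distribution W M E \<eta>) R * measure P {\<eta>}"
    using conditional_mixture[OF assms(4,5) joint(1) joint(2)[unfolded spectrum_borel_def]]
    unfolding X_cond_def X_out_def out_def vec_of_def by blast
  have out: "out \<eta> (outcome_event \<eta> A) \<in> sets borel" if A: "borel_family M \<eta> A" for \<eta> A
  proof -
    \<comment> \<open>Closedness of the spectrum makes its relatively Borel subsets Borel in the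
      line.\<close>
    have AB: "A i \<in> sets borel" if "\<eta> i" for i
      using A that by (simp add: borel_family_def sets_spectrum_borel_iff)
    have "out \<eta> (outcome_event \<eta> A) = {x \<in> space borel. \<forall>i\<in>{i. \<eta> i}. x $ i \<in> A i}"
      by (auto simp: out_def outcome_event_def restrict_PiE_iff)
    also have "\<dots> \<in> sets borel"
    proof (rule sets.sets_Collect_finite_All)
      fix i assume "i \<in> {i. \<eta> i}"
      then have "(\<lambda>x :: real^'n. x $ i) -` A i \<inter> space borel \<in> sets borel"
        using AB by (intro measurable_sets[of _ borel borel]) simp_all
      then show "{x :: real^'n \<in> space borel. x $ i \<in> A i} \<in> sets borel"
        by (simp add: vimage_def)
    qed simp
    finally show ?thesis .
  qed
  have "operator_trace (W \<circ> projector_product E \<eta> A) =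
      complex_of_real (measure p (X_out \<eta> (outcome_event \<eta> A) \<inter> X_cond {\<eta>}) / measure p (X_cond {\<eta>}))"
    if nz: "measure P {\<eta>} \<noteq> 0" and A: "borel_family M \<eta> A" for \<eta> A
  proof -
    have "outcome_event \<eta> A \<in> sets (joint_distribution W M E \<eta>)"
      unfolding joint(2)[OF nz] outcome_event_def
      using A by (intro sets_PiM_I_finite) (auto simp: borel_family_def)
    then show ?thesis
      using p(5)[OF nz out[OF A]] nz by (simp add: p(4) joint(3)[OF nz A, symmetric])
  qed
  moreover have "X_out \<eta> (outcome_event \<eta> A) \<in> sets p" if "borel_family M \<eta> A" for \<eta> A
    unfolding X_out_def p(2) by (rule borel_Times[OF out[OF that]]) simp
  \<comment> \<open>All of \<open>(real^'n) \<times> (real^'n)\<close> serves as the sample space;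
    the mass sits on the finitely many fibres over the vectors \<open>vec_of \<eta>\<close>.\<close>
  ultimately show ?thesis
    using p(1,2,3,4) joint(3)
    by (intro exI[of _ UNIV] exI[of _ p] exI[of _ X_cond] exI[of _ X_out]) (simp add: sets_restrict_space)
qed

end
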